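(* Fix an integer $d\geq 2$ and consider the Ising model on $\mathbb{T}^d$. Let $J_1,J_2>0$ and $h_1\in\mathbb{R}$ be given. Define \[ f_{\pm}(J_1,J_2,h_1)=\inf\{\,h\in\mathbb{R}:\mu_h^{J_2,+}\geq \mu_{h_1}^{J_1,\pm}\,\},\qquad g_{\pm}(J_1,J_2,h_1)=\inf\{\,h\in\mathbb{R}:\mu_h^{J_2,-}\geq \mu_{h_1}^{J_1,\pm}\,\}, \] and $\tau_\pm=t_{\pm}(J_1,h_1)+|J_1-J_2|$. Then \[ f_{\pm}(J_1,J_2,h_1)=\begin{cases} -h^*(J_2) &\text{if } t_-(J_2,-h^*(J_2))\leq \tau_\pm<t^*(J_2),\\ \tau_\pm-d\,\phi_{J_2}(\tau_\pm) &\text{if } \tau_\pm\geq t^*(J_2) \text{ or } \tau_\pm<t_-(J_2,-h^*(J_2)), \end{cases} \] \[ g_{\pm}(J_1,J_2,h_1)=\begin{cases} h^*(J_2) &\text{if } -t^*(J_2)< \tau_\pm\leq t_+(J_2,h^*(J_2)),\\ \tau_\pm-d\,\phi_{J_2}(\tau_\pm) &\text{if } \tau_\pm\leq -t^*(J_2) \text{ or } \tau_\pm>t_+(J_2,h^*(J_2)). \end{cases} \] (Each of $f_\pm$ and $g_\pm$ is meant with matching sign choice $\pm$ throughout.)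
   Context: $\mathbb{T}^d$ is the infinite tree in which every vertex has exactly $d+1$ neighbours. $\{-1,1\}^V$ carries the coordinatewise partial order and product topology; $\mu_1\leq\mu_2$ means $\int f\,d\mu_1\leq\int f\,d\mu_2$ for all real-valued continuous increasing $f$. For $J>0$, $h\in\mathbb{R}$, a Gibbs measure for the Ising model on a graph $G=(V,E)$ is a probability measure $\mu$ on $\{-1,1\}^V$ such that for all finite $U\subseteq V$, $\sigma\in\{-1,1\}^U$, $\eta\in\{-1,1\}^{V\setminus U}$, $\mu(X(U)=\sigma\mid X(V\setminus U)=\eta)$ is proportional to $\exp[J(\sum_{\langle x,y\rangle\in E, x,y\in U}\sigma(x)\sigma(y)+\sum_{\langle x,y\rangle\in E,x\in U,y\notin U}\sigma(x)\eta(y))+h\sum_{x\in U}\sigma(x)]$. The plus state $\mu_h^{J,+}$ (resp. minus state $\mu_h^{J,-}$) is the Gibbs measure that dominates (resp. is dominated by) every Gibbs measure with parameters $J,h$. For $J>0$ let $\phi_J(t)=\frac12\log\frac{\cosh(t+J)}{\cosh(t-J)}$, $t\in\mathbb{R}$. The equation $t=h+d\,\phi_J(t)$ has between one and three real solutions; $t_+(J,h)$ and $t_-(J,h)$ denote its largest and smallest real solution. Let $h^*(J)=\max_{t\geq 0}(d\,\phi_J(t)-t)$ and let $t^*(J)$ be the unique $t\geq0$ at which $t\mapsto d\,\phi_J(t)-t$ attains this maximum on $[0,\infty)$. *)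

theory Defs
  imports "HOL-Probability.Probability"
begin

text \<open>Concrete model: vertices are reduced words over the alphabet {0..d} (no two consecutive
letters equal), i.e. the Cayley graph of the free product of d+1 copies of Z/2; two words are
adjacent iff one is obtained from the other by appending one letter. Every vertex has exactly
d+1 neighbours and the graph is a tree.\<close>

definition tree_V :: "nat \<Rightarrow> nat list set" where
  "tree_V d = {xs. set xs \<subseteq> {..d} \<and> successively (\<noteq>) xs}"

definition tree_adj :: "nat \<Rightarrow> nat list \<Rightarrow> nat list \<Rightarrow> bool" where
  "tree_adj d x y \<longleftrightarrow> x \<in> tree_V d \<and> y \<in> tree_V d \<and>
     ((\<exists>i. y = x @ [i]) \<or> (\<exists>i. x = y @ [i]))"

definition spins :: "int set" where "spins = {-1, 1}"

definition cfg_space :: "nat \<Rightarrow> (nat list \<Rightarrow> int) set" where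
  "cfg_space d = PiE (tree_V d) (\<lambda>_. spins)"

definition cfg_M :: "nat \<Rightarrow> (nat list \<Rightarrow> int) measure" where
  "cfg_M d = PiM (tree_V d) (\<lambda>_. count_space spins)"

definition cfg_top :: "nat \<Rightarrow> (nat list \<Rightarrow> int) topology" where
  "cfg_top d = product_topology (\<lambda>_. discrete_topology spins) (tree_V d)"

definition increasing_fun :: "nat \<Rightarrow> ((nat list \<Rightarrow> int) \<Rightarrow> real) \<Rightarrow> bool" where
  "increasing_fun d f \<longleftrightarrow> (\<forall>\<omega>\<in>cfg_space d. \<forall>\<omega>'\<in>cfg_space d.
      (\<forall>x\<in>tree_V d. \<omega> x \<le> \<omega>' x) \<longrightarrow> f \<omega> \<le> f \<omega>')"

definition stoch_le :: "nat \<Rightarrow> (nat list \<Rightarrow> int) measure \<Rightarrow> (nat list \<Rightarrow> int) measure \<Rightarrow> bool" where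
  "stoch_le d \<mu>1 \<mu>2 \<longleftrightarrow> (\<forall>f. continuous_map (cfg_top d) euclideanreal f \<and> increasing_fun d f \<longrightarrow>
      (\<integral>\<omega>. f \<omega> \<partial>\<mu>1) \<le> (\<integral>\<omega>. f \<omega> \<partial>\<mu>2))"

text \<open>Exponent of the Ising weight in the finite set U, for spins sigma on U and boundary
condition eta outside U (edges counted once: ordered pairs inside U are halved).\<close>
definition ising_H :: "nat \<Rightarrow> real \<Rightarrow> real \<Rightarrow> nat list set \<Rightarrow> (nat list \<Rightarrow> int) \<Rightarrow> (nat list \<Rightarrow> int) \<Rightarrow> real" where
  "ising_H d J h U \<sigma> \<eta> =
     J * ((\<Sum>(x,y)\<in>{(x,y). x \<in> U \<and> y \<in> U \<and> tree_adj d x y}. real_of_int (\<sigma> x * \<sigma> y)) / 2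
        + (\<Sum>(x,y)\<in>{(x,y). x \<in> U \<and> y \<in> tree_V d - U \<and> tree_adj d x y}. real_of_int (\<sigma> x * \<eta> y)))
     + h * (\<Sum>x\<in>U. real_of_int (\<sigma> x))"

definition ising_spec :: "nat \<Rightarrow> real \<Rightarrow> real \<Rightarrow> nat list set \<Rightarrow> (nat list \<Rightarrow> int) \<Rightarrow> (nat list \<Rightarrow> int) \<Rightarrow> real" where
  "ising_spec d J h U \<sigma> \<eta> =
     exp (ising_H d J h U \<sigma> \<eta>) / (\<Sum>\<tau>\<in>PiE U (\<lambda>_. spins). exp (ising_H d J h U \<tau> \<eta>))"

definition is_gibbs :: "nat \<Rightarrow> real \<Rightarrow> real \<Rightarrow> (nat list \<Rightarrow> int) measure \<Rightarrow> bool" where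
  "is_gibbs d J h \<mu> \<longleftrightarrow> prob_space \<mu> \<and> sets \<mu> = sets (cfg_M d) \<and>
     (\<forall>U \<sigma> B. finite U \<longrightarrow> U \<subseteq> tree_V d \<longrightarrow> \<sigma> \<in> PiE U (\<lambda>_. spins) \<longrightarrow>
        B \<in> sets (cfg_M d) \<longrightarrow>
        (\<forall>\<omega>\<in>cfg_space d. \<forall>\<omega>'\<in>cfg_space d.
            (\<forall>x\<in>tree_V d - U. \<omega> x = \<omega>' x) \<longrightarrow> (\<omega> \<in> B \<longleftrightarrow> \<omega>' \<in> B)) \<longrightarrow>
        measure \<mu> ({\<omega>\<in>cfg_space d. \<forall>x\<in>U. \<omega> x = \<sigma> x} \<inter> B)
          = (\<integral>\<omega>. indicator B \<omega> * ising_spec d J h U \<sigma> \<omega> \<partial>\<mu>))"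

definition plus_state :: "nat \<Rightarrow> real \<Rightarrow> real \<Rightarrow> (nat list \<Rightarrow> int) measure" where
  "plus_state d J h = (THE \<mu>. is_gibbs d J h \<mu> \<and> (\<forall>\<nu>. is_gibbs d J h \<nu> \<longrightarrow> stoch_le d \<nu> \<mu>))"

definition minus_state :: "nat \<Rightarrow> real \<Rightarrow> real \<Rightarrow> (nat list \<Rightarrow> int) measure" where
  "minus_state d J h = (THE \<mu>. is_gibbs d J h \<mu> \<and> (\<forall>\<nu>. is_gibbs d J h \<nu> \<longrightarrow> stoch_le d \<mu> \<nu>))"

definition pm_state :: "nat \<Rightarrow> bool \<Rightarrow> real \<Rightarrow> real \<Rightarrow> (nat list \<Rightarrow> int) measure" where
  "pm_state d s J h = (if s then plus_state d J h else minus_state d J h)"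

definition phi :: "real \<Rightarrow> real \<Rightarrow> real" where
  "phi J t = ln (cosh (t + J) / cosh (t - J)) / 2"

definition t_plus :: "nat \<Rightarrow> real \<Rightarrow> real \<Rightarrow> real" where
  "t_plus d J h = (GREATEST t. t = h + real d * phi J t)"

definition t_minus :: "nat \<Rightarrow> real \<Rightarrow> real \<Rightarrow> real" where
  "t_minus d J h = (LEAST t. t = h + real d * phi J t)"

definition t_pm :: "nat \<Rightarrow> bool \<Rightarrow> real \<Rightarrow> real \<Rightarrow> real" where
  "t_pm d s J h = (if s then t_plus d J h else t_minus d J h)"

definition h_star :: "nat \<Rightarrow> real \<Rightarrow> real" where
  "h_star d J = (GREATEST v. \<exists>t\<ge>0. v = real d * phi J t - t)"

definition t_star :: "nat \<Rightarrow> real \<Rightarrow> real" where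
  "t_star d J = (THE t. t \<ge> 0 \<and> real d * phi J t - t = h_star d J)"

definition f_pm :: "nat \<Rightarrow> bool \<Rightarrow> real \<Rightarrow> real \<Rightarrow> real \<Rightarrow> real" where
  "f_pm d s J1 J2 h1 = Inf {h. stoch_le d (pm_state d s J1 h1) (plus_state d J2 h)}"

definition g_pm :: "nat \<Rightarrow> bool \<Rightarrow> real \<Rightarrow> real \<Rightarrow> real \<Rightarrow> real" where
  "g_pm d s J1 J2 h1 = Inf {h. stoch_le d (pm_state d s J1 h1) (minus_state d J2 h)}"

end

theory Submission
  imports Defs
begin

text \<open>For a field parameter \<open>t\<close> with \<open>t = h + d \<phi>_J(t)\<close> the homogeneous Markov chain on the tree in which a
  child of a vertex of spin \<open>s\<close> has field \<open>t + J s\<close> is a Gibbs measure. Conditioning any Gibbs measure on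
  the complement of a ball gives an inhomogeneous chain of the same kind, whose fields lie between the
  iterates of \<open>t \<mapsto> h + d \<phi>_J(t)\<close> started at \<open>h - d J\<close> and \<open>h + d J\<close>. These iterates converge to
  \<open>t_-\<close> and \<open>t_+\<close>, and realising all chains from the same uniform variables makes them monotone in the
  fields; hence the minus and plus states are the homogeneous chains with parameters \<open>t_-\<close> and \<open>t_+\<close>.

  The same coupling shows that the chain \<open>(J1, t1)\<close> is dominated by \<open>(J2, t2)\<close> if
  \<open>t1 \<plusminus> J1 \<le> t2 \<plusminus> J2\<close>, i.e. if \<open>t1 + |J1 - J2| \<le> t2\<close>. Conversely, domination compares the probabilities
  that a path of length \<open>n\<close> is all plus (all minus), which decay exponentially with rates given by
  \<open>t + J\<close> (\<open>t - J\<close>). The thresholds are therefore the infima of the \<open>h\<close> with \<open>\<tau> \<le> t_+(J2, h)\<close> and with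
  \<open>\<tau> \<le> t_-(J2, h)\<close>, which are read off from the shape of \<open>t \<mapsto> t - d \<phi>_J(t)\<close>.\<close>

section \<open>The fixed point equation\<close>

text \<open>The function \<open>phi\<close> comes from eliminating a child: the normaliser
  \<open>2 * cosh (b + J * s)\<close> of a spin with field b below a parent of spin s is a constant
  times \<open>exp (phi J b * s)\<close>, so the child acts on its parent as an extra field
  \<open>phi J b\<close>. The d children of a non-root vertex give the fixed point equation; the
  root has d + 1 children and needs a different field. Solved for h, the equation reads h = t - d
  \<phi>_J(t). This is an odd function of t, convex on t \<ge> 0, with minimum
  -\<open>h_star\<close> there, attained at \<open>t_star\<close>. As h grows, t_+ jumps at h =
  -\<open>h_star\<close> across the interval that ends at \<open>t_star\<close>, and by oddness t_-
  jumps at h = \<open>h_star\<close>; the constant branches of the two formulas are the values of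
  \<tau> skipped by these jumps. Two features of the definitions shape the proof. Domination is
  tested on all continuous increasing functions and the Gibbs property on all events outside U,
  whereas chains are computable on finite vertex sets; both are reduced to finitely many
  coordinates. The plus and minus states are definite descriptions, so domination has to be shown
  antisymmetric.\<close>

lemma phi_eq: "phi J t = (ln (cosh (t + J)) - ln (cosh (t - J))) / 2"
  unfolding phi_def by (simp add: ln_div)

lemma phi_minus: "phi J (- t) = - phi J t"
proof -
  have "- t + J = - (t - J)" "- t - J = - (t + J)" by simp_all
  then show ?thesis
    unfolding phi_eq by (simp only: cosh_minus) (simp add: field_simps)
qed

lemma phi_zero: "phi J 0 = 0"
  using phi_minus[of J 0] by simp

lemma cosh_prod_twice: "2 * (cosh (t + J) * cosh (t - J)) = cosh (2 * t) + cosh (2 * J)" for t J :: real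
proof -
  have "cosh ((t + J) + (t - J)) + cosh ((t + J) - (t - J)) = 2 * (cosh (t + J) * cosh (t - J))"
    by (simp only: cosh_add cosh_diff)
  then show ?thesis by simp
qed

text \<open>With the product of the two hyperbolic cosines turned into a sum, the derivative is
  visibly positive for J > 0 and decreasing in t \<ge> 0. The monotonicity and convexity arguments
  rest on this form.\<close>

lemma phi_deriv: "(phi J has_real_derivative sinh (2 * J) / (cosh (2 * t) + cosh (2 * J))) (at t)"
proof -
  have *: "((\<lambda>t. (ln (cosh (t + J)) - ln (cosh (t - J))) / 2) has_real_derivative
      (sinh (t + J) / cosh (t + J) - sinh (t - J) / cosh (t - J)) / 2) (at t)"
    by (auto intro!: derivative_eq_intros simp: divide_simps)
  have "sinh (2 * J) = sinh ((t + J) - (t - J))" by simp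
  also have "\<dots> = sinh (t + J) * cosh (t - J) - cosh (t + J) * sinh (t - J)" by (rule sinh_diff)
  finally have s: "sinh (2 * J) = sinh (t + J) * cosh (t - J) - cosh (t + J) * sinh (t - J)" .
  have "(sinh (t + J) / cosh (t + J) - sinh (t - J) / cosh (t - J)) / 2 =
      sinh (2 * J) / (cosh (2 * t) + cosh (2 * J))"
    unfolding s cosh_prod_twice[symmetric]
    by (simp add: diff_frac_eq mult.commute)
  with * show ?thesis
    by (simp add: phi_eq[abs_def])
qed

lemma phi_cont: "isCont (phi J) t"
  using phi_deriv DERIV_isCont by blast

lemma phi_mono:
  assumes "0 < J" "a \<le> b" shows "phi J a \<le> phi J b"
proof (rule DERIV_nonneg_imp_nondecreasing[OF assms(2)])
  fix x
  have "0 \<le> sinh (2 * J) / (cosh (2 * x) + cosh (2 * J))"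
    using assms(1) by (intro divide_nonneg_nonneg add_nonneg_nonneg) auto
  then show "\<exists>y. (phi J has_real_derivative y) (at x) \<and> 0 \<le> y"
    using phi_deriv by blast
qed

text \<open>Equivalent to \<open>cosh (t + J) \<le> exp (2 * J) * cosh (t - J)\<close>, which holds
  separately for the two exponentials in \<open>cosh\<close>. The bound confines the fixed points to
  within d J of h.\<close>

lemma phi_le:
  assumes "0 < J" shows "phi J t \<le> J"
proof -
  have "exp (- (2 * J)) * exp (- (t - J)) \<le> exp (2 * J) * exp (- (t - J))"
    using assms by (intro mult_right_mono) auto
  then have "exp (- (t + J)) \<le> exp (2 * J) * exp (- (t - J))"
    by (simp flip: exp_add add: algebra_simps)
  moreover have "exp (t + J) = exp (2 * J) * exp (t - J)"
    by (simp flip: exp_add)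
  ultimately have "cosh (t + J) \<le> exp (2 * J) * cosh (t - J)"
    unfolding cosh_def by (simp add: algebra_simps)
  then have "ln (cosh (t + J)) \<le> ln (exp (2 * J) * cosh (t - J))" by simp
  then show ?thesis by (simp add: phi_eq ln_mult)
qed

text \<open>This is strict concavity of \<open>phi J\<close> on the nonnegative half line, in terms
  of its derivative.\<close>

lemma phi_deriv_strict_antimono:
  fixes a b J :: real
  assumes "0 < J" "0 \<le> a" "a < b"
  shows "sinh (2 * J) / (cosh (2 * b) + cosh (2 * J)) < sinh (2 * J) / (cosh (2 * a) + cosh (2 * J))"
proof -
  have "cosh (2 * a) < cosh (2 * b)" using assms by (intro cosh_real_strict_mono) auto
  moreover have "0 < cosh (2 * a) + cosh (2 * J)" by (intro add_pos_pos) auto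
  ultimately show ?thesis using assms by (intro divide_strict_left_mono mult_pos_pos) auto
qed

section \<open>The external field as a function of the fixed point\<close>

definition ext_field :: "nat \<Rightarrow> real \<Rightarrow> real \<Rightarrow> real" where
  "ext_field d J t = t - real d * phi J t"

lemma ext_field_eq_iff: "t = h + real d * phi J t \<longleftrightarrow> ext_field d J t = h"
  by (auto simp: ext_field_def)

lemma ext_field_minus: "ext_field d J (- t) = - ext_field d J t"
  by (simp add: ext_field_def phi_minus)

lemma ext_field_cont: "isCont (ext_field d J) t"
  unfolding ext_field_def[abs_def] by (intro continuous_intros phi_cont)

lemma ext_field_ge: "0 < J \<Longrightarrow> t - real d * J \<le> ext_field d J t"
  using phi_le[of J t] by (simp add: ext_field_def mult_left_mono)

lemma ext_field_le: "0 < J \<Longrightarrow> ext_field d J t \<le> t + real d * J"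
  using ext_field_ge[of J "-t" d] by (simp add: ext_field_minus)

lemma ext_field_attains_above:
  assumes "0 < J" "ext_field d J a \<le> h"
  shows "\<exists>t\<ge>a. ext_field d J t = h"
proof -
  \<comment> \<open>Because \<open>phi J\<close> is at most J, the function
    \<open>ext_field d J\<close> is at least h from h + d J on.\<close>
  let ?b = "max a (h + real d * J)"
  have "h \<le> ext_field d J ?b" using ext_field_ge[OF assms(1), of ?b d] by linarith
  then show ?thesis
    using IVT[of "ext_field d J" a h ?b] assms(2) ext_field_cont by auto
qed

lemma ext_field_attains_below:
  assumes "0 < J" "h \<le> ext_field d J a"
  shows "\<exists>t\<le>a. ext_field d J t = h"
proof -
  obtain t where "- a \<le> t" "ext_field d J t = - h"
    using ext_field_attains_above[of J d "- a" "- h"] assms by (auto simp: ext_field_minus)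
  then show ?thesis by (intro exI[of _ "- t"]) (auto simp: ext_field_minus)
qed

text \<open>\<open>GREATEST\<close> has its meaning only once a maximum exists: the solutions form a
  nonempty closed set that is bounded above by h + d J.\<close>

lemma t_plus_greatest:
  assumes "0 < J"
  shows "ext_field d J (t_plus d J h) = h"
    and "ext_field d J t = h \<Longrightarrow> t \<le> t_plus d J h"
proof -
  let ?S = "{t. ext_field d J t = h}"
  have ne: "?S \<noteq> {}"
    using ext_field_attains_above[OF assms, of d "h - real d * J" h]
      ext_field_le[OF assms, of d "h - real d * J"] by auto
  have bdd: "bdd_above ?S"
  proof (rule bdd_aboveI)
    show "t \<le> h + real d * J" if "t \<in> ?S" for t
      using ext_field_ge[OF assms, of t d] that by simp
  qed
  have "closed (ext_field d J -` {h})"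
    by (intro continuous_closed_vimage ext_field_cont closed_singleton)
  then have cl: "closed ?S" by (simp add: vimage_def)
  have "Sup ?S \<in> ?S" by (rule closed_contains_Sup[OF ne bdd cl])
  then have "t_plus d J h = Sup ?S"
    unfolding t_plus_def ext_field_eq_iff
  proof (intro Greatest_equality)
    show "t \<le> Sup ?S" if "ext_field d J t = h" for t
      using that by (intro cSup_upper[OF _ bdd]) simp
  qed simp
  with \<open>Sup ?S \<in> ?S\<close> show "ext_field d J (t_plus d J h) = h"
    and "ext_field d J t = h \<Longrightarrow> t \<le> t_plus d J h"
    using cSup_upper[OF _ bdd, of t] by simp_all
qed

text \<open>The spin flip (t, h) \<mapsto> (-t, -h) preserves the fixed point equation and exchanges
  the two extreme solutions.\<close>

lemma t_minus_eq: 
  assumes "0 < J"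
  shows "t_minus d J h = - t_plus d J (- h)"
  unfolding t_minus_def ext_field_eq_iff
proof (rule Least_equality)
  show "ext_field d J (- t_plus d J (- h)) = h"
    using t_plus_greatest(1)[OF assms, of d "-h"] by (simp add: ext_field_minus)
  show "- t_plus d J (- h) \<le> t" if "ext_field d J t = h" for t
    using t_plus_greatest(2)[OF assms, of d "-t" "-h"] that by (simp add: ext_field_minus)
qed

lemma t_minus_least:
  assumes "0 < J"
  shows "ext_field d J (t_minus d J h) = h"
    and "ext_field d J t = h \<Longrightarrow> t_minus d J h \<le> t"
  using t_plus_greatest[OF assms, of d "- h"] t_plus_greatest(2)[OF assms, of d "-t" "- h"]
  by (simp_all add: t_minus_eq[OF assms] ext_field_minus)

text \<open>Since \<open>ext_field d J\<close> grows without bound, every point where it is at most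
  h has a solution to its right. The right-hand side no longer mentions a root, only values of one
  function on a ray.\<close>

lemma le_t_plus_iff:
  assumes "0 < J"
  shows "\<tau> \<le> t_plus d J h \<longleftrightarrow> (\<exists>t\<ge>\<tau>. ext_field d J t \<le> h)"
proof
  assume "\<exists>t\<ge>\<tau>. ext_field d J t \<le> h"
  then obtain t where "\<tau> \<le> t" "ext_field d J t = h"
    using ext_field_attains_above[OF assms] order_trans by metis
  then show "\<tau> \<le> t_plus d J h" using t_plus_greatest(2)[OF assms, of d t h] by linarith
qed (use t_plus_greatest(1)[OF assms] in auto)

text \<open>A point t < \<tau> with value exactly h is itself a solution below \<tau>, hence the
  strict inequality, in contrast to \<open>le_t_plus_iff\<close>. It is why the set of admissible h
  can be an open half line.\<close>

lemma le_t_minus_iff: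
  assumes "0 < J"
  shows "\<tau> \<le> t_minus d J h \<longleftrightarrow> (\<forall>t<\<tau>. ext_field d J t < h)"
proof -
  have "t_minus d J h < \<tau> \<longleftrightarrow> (\<exists>t<\<tau>. h \<le> ext_field d J t)"
  proof
    assume "\<exists>t<\<tau>. h \<le> ext_field d J t"
    then obtain t where "t < \<tau>" "ext_field d J t = h"
      using ext_field_attains_below[OF assms] order_le_less_trans by metis
    then show "t_minus d J h < \<tau>" using t_minus_least(2)[OF assms, of d t h] by linarith
  qed (use t_minus_least(1)[OF assms] in auto)
  then show ?thesis by (meson not_le)
qed

lemma ext_field_deriv:
  "(ext_field d J has_real_derivative 1 - real d * (sinh (2 * J) / (cosh (2 * t) + cosh (2 * J)))) (at t)"
  unfolding ext_field_def[abs_def] by (auto intro!: derivative_eq_intros phi_deriv)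

text \<open>The derivative is strictly increasing on t \<ge> 0, and by the mean value theorem it is
  nonnegative somewhere between the minimiser and any later point; so it is positive to the right of
  the minimiser. The argument also covers a minimiser at the end point 0, where the derivative need
  not vanish.\<close>

lemma ext_field_min_mono:
  assumes J: "0 < J" and d: "1 \<le> d" and a: "0 \<le> a"
    and min: "\<And>t. 0 \<le> t \<Longrightarrow> ext_field d J a \<le> ext_field d J t"
    and xy: "a \<le> x" "x < y"
  shows "ext_field d J x < ext_field d J y"
proof -
  let ?D = "\<lambda>t. 1 - real d * (sinh (2 * J) / (cosh (2 * t) + cosh (2 * J)))"
  have D: "?D u < ?D v" if "0 \<le> u" "u < v" for u v
    using mult_strict_left_mono[OF phi_deriv_strict_antimono[OF J that], of "real d"] d by simp
  have "0 < ?D v" if v: "a < v" for v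
  proof -
    obtain z where z: "a < z" "z < v" "ext_field d J v - ext_field d J a = (v - a) * ?D z"
      using MVT2[OF v, of "ext_field d J" ?D] ext_field_deriv by blast
    have "0 \<le> (v - a) * ?D z" using min[of v] z a by simp
    then have "0 \<le> ?D z" using v by (simp add: zero_le_mult_iff)
    then show ?thesis using D[of z v] z a by linarith
  qed
  moreover obtain z where "x < z" "z < y" "ext_field d J y - ext_field d J x = (y - x) * ?D z"
    using MVT2[OF xy(2), of "ext_field d J" ?D] ext_field_deriv by blast
  ultimately have "0 < ext_field d J y - ext_field d J x" using xy by simp
  then show ?thesis by simp
qed

text \<open>Beyond d J the function is at least 0, its value at the origin, so minimising over a
  compact interval suffices. Two minimisers would contradict the strict growth to the right of the
  smaller one, which makes the definite description \<open>t_star\<close> meaningful.\<close>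

lemma t_star_minimizes:
  assumes J: "0 < J" and d: "1 \<le> d"
  shows "0 \<le> t_star d J" "ext_field d J (t_star d J) = - h_star d J"
    and "\<And>t. 0 \<le> t \<Longrightarrow> - h_star d J \<le> ext_field d J t"
proof -
  let ?F = "ext_field d J"
  have "\<exists>a\<in>{0..real d * J}. \<forall>t\<in>{0..real d * J}. ?F a \<le> ?F t"
    using J ext_field_cont
    by (intro continuous_attains_inf) (auto intro!: continuous_at_imp_continuous_on)
  then obtain a where a: "0 \<le> a" and min0: "\<And>t. 0 \<le> t \<Longrightarrow> t \<le> real d * J \<Longrightarrow> ?F a \<le> ?F t"
    by auto
  have min: "?F a \<le> ?F t" if "0 \<le> t" for t
  proof (cases "t \<le> real d * J")
    case False
    have "?F a \<le> ?F 0" using min0[of 0] J by simp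
    also have "\<dots> = 0" by (simp add: ext_field_def phi_zero)
    also have "\<dots> \<le> ?F t" using False ext_field_ge[OF J, of t d] by linarith
    finally show ?thesis .
  qed (use that min0 in simp)
  have rw: "real d * phi J t - t = - ?F t" for t by (simp add: ext_field_def)
  have hs: "h_star d J = - ?F a"
    unfolding h_star_def rw using a min by (intro Greatest_equality) auto
  have "t = a" if "0 \<le> t" "?F t = ?F a" for t
  proof (rule ccontr)
    assume "t \<noteq> a"
    then consider "a < t" | "t < a" by linarith
    then show False
    proof cases
      case 1
      then show False using ext_field_min_mono[OF J d a min, of a t] that by simp
    next
      case 2
      have "?F t \<le> ?F u" if "0 \<le> u" for u using min[OF that] \<open>?F t = ?F a\<close> by simp
      from ext_field_min_mono[OF J d \<open>0 \<le> t\<close> this, of t a] 2 that show False by simp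
    qed
  qed
  then have ts: "t_star d J = a"
    unfolding t_star_def rw hs using a by (intro the_equality) auto
  show "0 \<le> t_star d J" "?F (t_star d J) = - h_star d J"
    and "\<And>t. 0 \<le> t \<Longrightarrow> - h_star d J \<le> ?F t"
    using ts hs a min by auto
qed

lemma ext_field_mono_left:
  assumes "0 < J" "1 \<le> d" "x \<le> y" "y \<le> - t_star d J"
  shows "ext_field d J x \<le> ext_field d J y"
proof (cases "x = y")
  case False
  have "ext_field d J (- y) < ext_field d J (- x)"
    using t_star_minimizes[OF assms(1,2)] assms False
    by (intro ext_field_min_mono[of J d "t_star d J"]) auto
  then show ?thesis by (simp add: ext_field_minus)
qed simp

lemma ext_field_mono_right:
  assumes "0 < J" "1 \<le> d" "t_star d J \<le> x" "x \<le> y"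
  shows "ext_field d J x \<le> ext_field d J y"
  using ext_field_mono_left[of J d "-y" "-x"] assms by (simp add: ext_field_minus)

text \<open>Between -\<open>t_star\<close> and 0 the function is even nonnegative: by oddness this
  says that it is at most 0 on the interval from 0 to \<open>t_star\<close>, where it is convex with
  values 0 and -\<open>h_star\<close> \<le> 0 at the ends. In terms of derivatives, a positive value
  would force a positive derivative before it, hence growth all the way to
  \<open>t_star\<close>.\<close>

lemma ext_field_ge_middle:
  assumes J: "0 < J" and d: "1 \<le> d" and t: "- t_star d J \<le> t"
  shows "- h_star d J \<le> ext_field d J t"
proof (cases "0 \<le> t")
  case True
  then show ?thesis using t_star_minimizes[OF J d] by blast
next
  case False
  have F0: "ext_field d J 0 = 0" by (simp add: ext_field_def phi_zero)
  have h: "0 \<le> h_star d J" using t_star_minimizes(3)[OF J d, of 0] F0 by simp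
  have "0 \<le> ext_field d J t"
  proof (rule ccontr)
    assume neg: "\<not> 0 \<le> ext_field d J t"
    let ?D = "\<lambda>t. 1 - real d * (sinh (2 * J) / (cosh (2 * t) + cosh (2 * J)))"
    have D: "?D u < ?D v" if "0 \<le> u" "u < v" for u v
      using mult_strict_left_mono[OF phi_deriv_strict_antimono[OF J that], of "real d"] d by simp
    have pos: "0 < ext_field d J (- t)" using neg by (simp add: ext_field_minus)
    obtain z where z: "0 < z" "z < - t" "ext_field d J (- t) - ext_field d J 0 = (- t - 0) * ?D z"
      using MVT2[of 0 "-t" "ext_field d J" ?D] ext_field_deriv False by auto
    then have "0 < - t * ?D z" using pos F0 by simp
    then have Dz: "0 < ?D z" using False by (simp only: zero_less_mult_iff) linarith
    show False
    proof (cases "- t = t_star d J")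
      case True
      then show False using pos t_star_minimizes(2)[OF J d] h by simp
    next
      case ne: False
      then obtain w where w: "- t < w" "ext_field d J (t_star d J) - ext_field d J (- t) = (t_star d J - - t) * ?D w"
        using MVT2[of "-t" "t_star d J" "ext_field d J" ?D] ext_field_deriv t by fastforce
      have "0 < ?D w" using D[of z w] z w Dz by linarith
      then have "0 < (t_star d J - - t) * ?D w" using ne t by (intro mult_pos_pos) auto
      then show False using w pos t_star_minimizes(2)[OF J d] h by linarith
    qed
  qed
  with h show ?thesis by simp
qed

text \<open>The graph rises up to -\<open>t_star\<close>, stays at or above -\<open>h_star\<close>
  afterwards, and rises again from \<open>t_star\<close> on. So for \<tau> < \<open>t_star\<close>
  the minimum over the ray from \<tau> depends only on whether \<tau> still lies on the left branch
  below the level -\<open>h_star\<close>; that branch crosses the level at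
  \<open>t_minus d J (- h_star d J)\<close>.\<close>

lemma ext_field_min_ray:
  assumes J: "0 < J" and d: "1 \<le> d"
  shows "t_minus d J (- h_star d J) \<le> \<tau> \<Longrightarrow> \<tau> < t_star d J \<Longrightarrow>
      t_star d J \<ge> \<tau> \<and> ext_field d J (t_star d J) = - h_star d J \<and> (\<forall>t\<ge>\<tau>. - h_star d J \<le> ext_field d J t)"
    and "\<tau> \<ge> t_star d J \<or> \<tau> < t_minus d J (- h_star d J) \<Longrightarrow> \<forall>t\<ge>\<tau>. ext_field d J \<tau> \<le> ext_field d J t"
proof -
  note ts = t_star_minimizes[OF J d]
  note tm = t_minus_least[OF J, of d "- h_star d J"]
  have low: "- h_star d J \<le> ext_field d J t" if "t_minus d J (- h_star d J) \<le> t" for t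
  proof (cases "- t_star d J \<le> t")
    case False
    then show ?thesis using ext_field_mono_left[OF J d that] tm(1) by simp
  qed (use ext_field_ge_middle[OF J d] in blast)
  show "t_star d J \<ge> \<tau> \<and> ext_field d J (t_star d J) = - h_star d J \<and> (\<forall>t\<ge>\<tau>. - h_star d J \<le> ext_field d J t)"
    if "t_minus d J (- h_star d J) \<le> \<tau>" "\<tau> < t_star d J"
    using low that ts by auto
  show "\<forall>t\<ge>\<tau>. ext_field d J \<tau> \<le> ext_field d J t"
    if "\<tau> \<ge> t_star d J \<or> \<tau> < t_minus d J (- h_star d J)"
    using that
  proof
    assume "\<tau> \<ge> t_star d J"
    then show ?thesis using ext_field_mono_right[OF J d] by blast
  next
    assume l: "\<tau> < t_minus d J (- h_star d J)"
    have "ext_field d J \<tau> < - h_star d J"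
    proof (rule ccontr)
      assume "\<not> ext_field d J \<tau> < - h_star d J"
      then obtain t where "t \<le> \<tau>" "ext_field d J t = - h_star d J"
        using ext_field_attains_below[OF J, of "- h_star d J" d \<tau>] by auto
      then show False using t_minus_least(2)[OF J] l by fastforce
    qed
    moreover have "ext_field d J \<tau> \<le> ext_field d J t \<or> - h_star d J \<le> ext_field d J t" if "\<tau> \<le> t" for t
      using ext_field_mono_left[OF J d that] ext_field_ge_middle[OF J d, of t] by linarith
    ultimately show ?thesis by fastforce
  qed
qed

lemma Inf_le_t_plus:
  assumes J: "0 < J" and d: "1 \<le> d"
  defines "I \<equiv> \<lambda>\<tau>. Inf {h. \<tau> \<le> t_plus d J h}"
  shows "t_minus d J (- h_star d J) \<le> \<tau> \<Longrightarrow> \<tau> < t_star d J \<Longrightarrow> I \<tau> = - h_star d J"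
    and "\<tau> \<ge> t_star d J \<or> \<tau> < t_minus d J (- h_star d J) \<Longrightarrow> I \<tau> = ext_field d J \<tau>"
proof -
  have "I \<tau> = m" if "a \<ge> \<tau>" "ext_field d J a = m" "\<forall>t\<ge>\<tau>. m \<le> ext_field d J t" for a m
  proof -
    have "{h. \<tau> \<le> t_plus d J h} = {m..}"
      using that by (auto simp: le_t_plus_iff[OF J] intro: order_trans)
    then show ?thesis by (simp add: I_def)
  qed
  then show "t_minus d J (- h_star d J) \<le> \<tau> \<Longrightarrow> \<tau> < t_star d J \<Longrightarrow> I \<tau> = - h_star d J"
    and "\<tau> \<ge> t_star d J \<or> \<tau> < t_minus d J (- h_star d J) \<Longrightarrow> I \<tau> = ext_field d J \<tau>"
    using ext_field_min_ray[OF J d, of \<tau>] by blast+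
qed

text \<open>By oddness the number sought is the maximum m over all t \<le> \<tau>, read off from
  \<open>ext_field_min_ray\<close> at -\<tau>. Whether h = m is admissible depends on whether m is
  attained before \<tau>; for the infimum it is enough to enclose the set between the open and the
  closed half line at m.\<close>

lemma Inf_le_t_minus:
  assumes J: "0 < J" and d: "1 \<le> d"
  defines "I \<equiv> \<lambda>\<tau>. Inf {h. \<tau> \<le> t_minus d J h}"
  shows "- t_star d J < \<tau> \<Longrightarrow> \<tau> \<le> t_plus d J (h_star d J) \<Longrightarrow> I \<tau> = h_star d J"
    and "\<tau> \<le> - t_star d J \<or> \<tau> > t_plus d J (h_star d J) \<Longrightarrow> I \<tau> = ext_field d J \<tau>"
proof -
  have *: "I \<tau> = m" if a: "a \<le> \<tau>" "ext_field d J a = m" "\<And>t. t \<le> \<tau> \<Longrightarrow> ext_field d J t \<le> m" for a m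
  proof -
    have "m \<le> h" if h: "\<forall>t<\<tau>. ext_field d J t < h" for h
    proof (cases "a < \<tau>")
      case True
      then show ?thesis using h a by auto
    next
      case False
      then have "a = \<tau>" using a by simp
      \<comment> \<open>The maximum sits at \<tau> itself, where the bound on t < \<tau> does not
        apply directly; the limit from the left transfers it.\<close>
      have "(ext_field d J \<longlongrightarrow> ext_field d J \<tau>) (at_left \<tau>)"
        using ext_field_cont unfolding isCont_def by (rule filterlim_at_split[THEN iffD1, THEN conjunct1])
      moreover have "\<forall>\<^sub>F t in at_left \<tau>. ext_field d J t \<le> h"
        using h by (auto simp: eventually_at_filter less_imp_le)
      ultimately have "ext_field d J \<tau> \<le> h"
        by (intro tendsto_upperbound[of "ext_field d J" _ "at_left \<tau>"]) auto
      then show ?thesis using \<open>a = \<tau>\<close> a by simp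
    qed
    moreover have "\<tau> \<le> t_minus d J h" if "m < h" for h
      unfolding le_t_minus_iff[OF J] using a(3) that by (meson less_imp_le order_le_less_trans)
    ultimately have "{m<..} \<subseteq> {h. \<tau> \<le> t_minus d J h}" "{h. \<tau> \<le> t_minus d J h} \<subseteq> {m..}"
      by (auto simp: le_t_minus_iff[OF J])
    moreover have "m + 1 \<in> {m<..}" by simp
    ultimately have "I \<tau> \<le> Inf {m<..}" "Inf {m..} \<le> I \<tau>"
      unfolding I_def by (intro cInf_superset_mono bdd_belowI[of _ m]; blast)+
    then show ?thesis by simp
  qed
  have eq: "t_minus d J (- h_star d J) = - t_plus d J (h_star d J)"
    by (simp add: t_minus_eq[OF J])
  have conv: "(\<forall>t\<ge>- \<tau>. m \<le> ext_field d J t) \<Longrightarrow> t \<le> \<tau> \<Longrightarrow> ext_field d J t \<le> - m" for t m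
    by (drule spec[of _ "- t"]) (simp add: ext_field_minus)
  show "I \<tau> = h_star d J" if "- t_star d J < \<tau>" "\<tau> \<le> t_plus d J (h_star d J)"
  proof -
    have "- \<tau> \<le> t_star d J \<and> ext_field d J (t_star d J) = - h_star d J \<and> (\<forall>t\<ge>- \<tau>. - h_star d J \<le> ext_field d J t)"
      using ext_field_min_ray(1)[OF J d, of "- \<tau>"] that eq by simp
    then show ?thesis
      using conv[of "- h_star d J"] by (intro *[of "- t_star d J"]) (auto simp: ext_field_minus)
  qed
  show "I \<tau> = ext_field d J \<tau>" if "\<tau> \<le> - t_star d J \<or> \<tau> > t_plus d J (h_star d J)"
  proof -
    have "\<forall>t\<ge>- \<tau>. - ext_field d J \<tau> \<le> ext_field d J t"
      using ext_field_min_ray(2)[OF J d, of "- \<tau>"] that eq by (auto simp: ext_field_minus)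
    then show ?thesis
      using conv[of "- ext_field d J \<tau>"] by (intro *[of \<tau>]) auto
  qed
qed

section \<open>Configurations on the tree\<close>

lemma Nil_in_tree_V [simp]: "[] \<in> tree_V d"
  by (simp add: tree_V_def)

lemma append_in_tree_V:
  "x @ [i] \<in> tree_V d \<longleftrightarrow> x \<in> tree_V d \<and> i \<le> d \<and> (x = [] \<or> last x \<noteq> i)"
  by (auto simp: tree_V_def successively_append_iff)

lemma butlast_in_tree_V:
  assumes "x \<in> tree_V d" shows "butlast x \<in> tree_V d"
  using assms by (cases x rule: rev_cases) (auto simp: append_in_tree_V)

definition children :: "nat \<Rightarrow> nat list \<Rightarrow> nat list set" where
  "children d x = {y \<in> tree_V d. y \<noteq> [] \<and> butlast y = x}"

lemma children_eq:
  assumes "x \<in> tree_V d"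
  shows "children d x = (\<lambda>i. x @ [i]) ` {i. i \<le> d \<and> (x = [] \<or> i \<noteq> last x)}"
proof -
  have "y \<in> (\<lambda>i. x @ [i]) ` {i. i \<le> d \<and> (x = [] \<or> i \<noteq> last x)}" if "y \<in> children d x" for y
    using that by (cases y rule: rev_cases) (auto simp: children_def append_in_tree_V)
  then show ?thesis using assms append_in_tree_V[of "[]" _ d] by (auto simp: children_def append_in_tree_V)
qed

lemma finite_children [simp]: "x \<in> tree_V d \<Longrightarrow> finite (children d x)"
  by (simp add: children_eq)

lemma card_children:
  assumes "x \<in> tree_V d"
  shows "card (children d x) = (if x = [] then d + 1 else d)"
proof -
  have "card (children d x) = card {i. i \<le> d \<and> (x = [] \<or> i \<noteq> last x)}"
    unfolding children_eq[OF assms] by (intro card_image) (auto simp: inj_on_def)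
  also have "\<dots> = (if x = [] then d + 1 else d)"
  proof (cases "x = []")
    case False
    then have "last x \<in> set x" by simp
    then have "last x \<in> {..d}" using assms by (auto simp: tree_V_def)
    moreover have "{i. i \<le> d \<and> (x = [] \<or> i \<noteq> last x)} = {..d} - {last x}" using False by auto
    ultimately show ?thesis using False by simp
  qed (simp add: atMost_def[symmetric])
  finally show ?thesis .
qed

definition tree_ball :: "nat \<Rightarrow> nat \<Rightarrow> nat list set" where
  "tree_ball d n = {x \<in> tree_V d. length x \<le> n}"

lemma finite_tree_ball [simp]: "finite (tree_ball d n)"
proof (rule finite_subset)
  show "tree_ball d n \<subseteq> {x. set x \<subseteq> {..d} \<and> length x \<le> n}" by (auto simp: tree_ball_def tree_V_def)
qed (simp add: finite_lists_length_le)

lemma tree_ball_subset: "tree_ball d n \<subseteq> tree_V d"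
  by (auto simp: tree_ball_def)

lemma finite_subset_ball:
  assumes "finite A" "A \<subseteq> tree_V d" shows "\<exists>n. A \<subseteq> tree_ball d n"
proof -
  have "length x \<le> Max (length ` A)" if "x \<in> A" for x
    using that assms by simp
  then show ?thesis using assms by (intro exI[of _ "Max (length ` A)"]) (auto simp: tree_ball_def)
qed

lemma tree_ball_mono: "m \<le> n \<Longrightarrow> tree_ball d m \<subseteq> tree_ball d n"
  by (auto simp: tree_ball_def)

text \<open>Inside the tree, the nonempty sets of this kind are the subtrees containing the root. On
  them every non-root spin is sampled from a parent in the same set, so cylinder probabilities
  become products.\<close>

definition prefix_closed :: "nat list set \<Rightarrow> bool" where
  "prefix_closed A \<longleftrightarrow> (\<forall>x\<in>A. x \<noteq> [] \<longrightarrow> butlast x \<in> A)"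

lemma prefix_closed_tree_ball: "prefix_closed (tree_ball d n)"
  by (auto simp: prefix_closed_def tree_ball_def butlast_in_tree_V)

text \<open>An edge is represented by its endpoint farther from the root; the left side is thus a
  sum over the edges of the ball, and the right side regroups them by parents.\<close>

lemma sum_edges_ball:
  fixes g :: "nat list \<Rightarrow> real"
  shows "(\<Sum>y\<in>tree_ball d n - {[]}. g y) = (\<Sum>x\<in>{x \<in> tree_ball d n. length x < n}. \<Sum>y\<in>children d x. g y)"
proof -
  have un: "tree_ball d n - {[]} = (\<Union>x\<in>{x \<in> tree_ball d n. length x < n}. children d x)"
  proof (intro equalityI subsetI)
    fix y assume "y \<in> tree_ball d n - {[]}"
    then show "y \<in> (\<Union>x\<in>{x \<in> tree_ball d n. length x < n}. children d x)"
      by (cases y rule: rev_cases) (auto simp: tree_ball_def children_def append_in_tree_V)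
  qed (auto simp: tree_ball_def children_def)
  show ?thesis unfolding un
  proof (rule sum.UNION_disjoint)
    show "\<forall>x\<in>{x \<in> tree_ball d n. length x < n}. finite (children d x)" by (auto simp: tree_ball_def)
  qed (auto simp: children_def)
qed

section \<open>Spin configurations, cylinders and local functions\<close>

lemma finite_spins [simp]: "finite spins"
  by (simp add: spins_def)

lemma spins_cases: "s \<in> spins \<Longrightarrow> s = - 1 \<or> s = 1"
  by (auto simp: spins_def)

lemma space_cfg_M [simp]: "space (cfg_M d) = cfg_space d"
  by (simp add: cfg_M_def cfg_space_def space_PiM)

lemma topspace_cfg_top [simp]: "topspace (cfg_top d) = cfg_space d"
  by (simp add: cfg_top_def cfg_space_def)

lemma cfg_space_spin: "\<omega> \<in> cfg_space d \<Longrightarrow> x \<in> tree_V d \<Longrightarrow> \<omega> x \<in> spins"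
  by (auto simp: cfg_space_def)

definition cyl :: "nat \<Rightarrow> nat list set \<Rightarrow> (nat list \<Rightarrow> int) \<Rightarrow> (nat list \<Rightarrow> int) set" where
  "cyl d A \<sigma> = {\<omega> \<in> cfg_space d. \<forall>x\<in>A. \<omega> x = \<sigma> x}"

text \<open>Extends a partial configuration to an element of \<open>cfg_space d\<close>, which must
  be undefined off the tree. The value -1 outside A does not affect functions local to A; being
  constant, it also preserves the order of configurations.\<close>

definition fill :: "nat \<Rightarrow> nat list set \<Rightarrow> (nat list \<Rightarrow> int) \<Rightarrow> nat list \<Rightarrow> int" where
  "fill d A \<sigma> = (\<lambda>x\<in>tree_V d. if x \<in> A then \<sigma> x else - 1)"

lemma fill_in_cfg_space:
  assumes "\<And>x. x \<in> A \<Longrightarrow> x \<in> tree_V d \<Longrightarrow> \<sigma> x \<in> spins"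
  shows "fill d A \<sigma> \<in> cfg_space d"
  using assms by (auto simp: fill_def cfg_space_def spins_def)

lemma coordinate_measurable [measurable]:
  "x \<in> tree_V d \<Longrightarrow> (\<lambda>\<omega>. \<omega> x) \<in> cfg_M d \<rightarrow>\<^sub>M count_space spins"
  unfolding cfg_M_def by (rule measurable_component_singleton)

lemma cyl_sets [measurable]:
  assumes "finite A" "A \<subseteq> tree_V d"
  shows "cyl d A \<sigma> \<in> sets (cfg_M d)"
proof -
  have "{\<omega> \<in> space (cfg_M d). \<forall>x\<in>A. \<omega> x = \<sigma> x} \<in> sets (cfg_M d)"
  proof (rule sets.sets_Collect_finite_All[OF _ assms(1)])
    fix x assume "x \<in> A"
    then have x: "x \<in> tree_V d" using assms by auto
    have "(\<lambda>\<omega>. \<omega> x) -` ({\<sigma> x} \<inter> spins) \<inter> space (cfg_M d) \<in> sets (cfg_M d)"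
      by (rule measurable_sets[OF coordinate_measurable[OF x]]) simp
    also have "(\<lambda>\<omega>. \<omega> x) -` ({\<sigma> x} \<inter> spins) \<inter> space (cfg_M d) = {\<omega> \<in> space (cfg_M d). \<omega> x = \<sigma> x}"
      using cfg_space_spin[OF _ x] by auto
    finally show "{\<omega> \<in> space (cfg_M d). \<omega> x = \<sigma> x} \<in> sets (cfg_M d)" .
  qed
  then show ?thesis by (simp add: cyl_def)
qed

lemma cyl_open:
  assumes "finite A" "A \<subseteq> tree_V d" "\<And>x. x \<in> A \<Longrightarrow> \<sigma> x \<in> spins"
  shows "openin (cfg_top d) (cyl d A \<sigma>)"
proof -
  have eq: "cyl d A \<sigma> = PiE (tree_V d) (\<lambda>x. if x \<in> A then {\<sigma> x} else spins)"
  proof (intro equalityI subsetI)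
    fix \<omega> assume \<omega>: "\<omega> \<in> PiE (tree_V d) (\<lambda>x. if x \<in> A then {\<sigma> x} else spins)"
    have "\<omega> x \<in> (if x \<in> A then {\<sigma> x} else spins)" if "x \<in> tree_V d" for x
      using PiE_mem[OF \<omega> that] .
    then have "\<omega> x \<in> spins \<and> (x \<in> A \<longrightarrow> \<omega> x = \<sigma> x)" if "x \<in> tree_V d" for x
      using that assms(3) by (metis singletonD)
    then show "\<omega> \<in> cyl d A \<sigma>"
      using \<omega> assms(2) by (auto simp: cyl_def cfg_space_def PiE_iff)
  qed (simp add: cyl_def cfg_space_def PiE_iff)
  have "finite {x \<in> tree_V d. (if x \<in> A then {\<sigma> x} else spins) \<noteq> spins}"
    by (rule finite_subset[OF _ assms(1)]) (auto split: if_splits)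
  then show ?thesis
    unfolding eq cfg_top_def using assms(3) by (auto simp: openin_PiE_gen)
qed

definition local_fun :: "nat \<Rightarrow> nat list set \<Rightarrow> ((nat list \<Rightarrow> int) \<Rightarrow> 'b) \<Rightarrow> bool" where
  "local_fun d A g \<longleftrightarrow> finite A \<and> A \<subseteq> tree_V d \<and>
     (\<forall>\<omega>\<in>cfg_space d. \<forall>\<omega>'\<in>cfg_space d. (\<forall>x\<in>A. \<omega> x = \<omega>' x) \<longrightarrow> g \<omega> = g \<omega>')"

lemma local_funD:
  assumes "local_fun d A g" "\<omega> \<in> cfg_space d" "\<omega>' \<in> cfg_space d" "\<And>x. x \<in> A \<Longrightarrow> \<omega> x = \<omega>' x"
  shows "g \<omega> = g \<omega>'"
  using assms unfolding local_fun_def by blast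

lemma local_fun_mono:
  assumes "local_fun d A g" "A \<subseteq> B" "finite B" "B \<subseteq> tree_V d"
  shows "local_fun d B g"
  using assms unfolding local_fun_def by blast

lemma local_fun_ball:
  assumes "local_fun d A g" obtains n where "\<And>m. n \<le> m \<Longrightarrow> local_fun d (tree_ball d m) g"
proof -
  obtain n where "A \<subseteq> tree_ball d n"
    using finite_subset_ball[of A d] assms by (auto simp: local_fun_def)
  then have "local_fun d (tree_ball d m) g" if "n \<le> m" for m
    using local_fun_mono[OF assms, of "tree_ball d m"] tree_ball_mono[OF that, of d] tree_ball_subset by auto
  then show ?thesis by (rule that)
qed

text \<open>Exactly one cylinder over A contains \<omega>. This reduces measurability and integrals
  of local functions to cylinder events.\<close>

lemma local_fun_expand:
  fixes g :: "(nat list \<Rightarrow> int) \<Rightarrow> real"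
  assumes g: "local_fun d A g" and \<omega>: "\<omega> \<in> cfg_space d"
  shows "g \<omega> = (\<Sum>\<sigma>\<in>PiE A (\<lambda>_. spins). g (fill d A \<sigma>) * indicator (cyl d A \<sigma>) \<omega>)"
proof -
  have A: "finite A" "A \<subseteq> tree_V d" using g by (auto simp: local_fun_def)
  let ?\<sigma> = "restrict \<omega> A"
  have \<sigma>: "?\<sigma> \<in> PiE A (\<lambda>_. spins)" using A \<omega> cfg_space_spin by fastforce
  have ind: "indicator (cyl d A \<sigma>) \<omega> = (if \<sigma> = ?\<sigma> then 1 else 0::real)" if "\<sigma> \<in> PiE A (\<lambda>_. spins)" for \<sigma>
  proof -
    have "\<sigma> = ?\<sigma> \<longleftrightarrow> (\<forall>x\<in>A. \<omega> x = \<sigma> x)"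
    proof
      assume "\<forall>x\<in>A. \<omega> x = \<sigma> x"
      then show "\<sigma> = ?\<sigma>" using that by (intro PiE_ext[OF that \<sigma>]) auto
    qed (metis restrict_apply)
    then show ?thesis using \<omega> by (auto simp: cyl_def)
  qed
  have "(\<Sum>\<sigma>\<in>PiE A (\<lambda>_. spins). g (fill d A \<sigma>) * indicator (cyl d A \<sigma>) \<omega>)
      = (\<Sum>\<sigma>\<in>PiE A (\<lambda>_. spins). if \<sigma> = ?\<sigma> then g (fill d A \<sigma>) else 0)"
    by (intro sum.cong) (auto simp: ind)
  also have "\<dots> = g (fill d A ?\<sigma>)" using \<sigma> A by (simp add: sum.delta finite_PiE)
  also have "\<dots> = g \<omega>"
  proof (rule local_funD[OF g _ \<omega>])
    show "fill d A ?\<sigma> \<in> cfg_space d" using \<omega> cfg_space_spin by (intro fill_in_cfg_space) auto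
    show "fill d A ?\<sigma> x = \<omega> x" if "x \<in> A" for x using that A by (auto simp: fill_def)
  qed
  finally show ?thesis by simp
qed

lemma local_fun_measurable:
  fixes g :: "(nat list \<Rightarrow> int) \<Rightarrow> real"
  assumes g: "local_fun d A g" shows "g \<in> borel_measurable (cfg_M d)"
proof -
  have [measurable]: "cyl d A \<sigma> \<in> sets (cfg_M d)" for \<sigma>
    using g by (intro cyl_sets) (auto simp: local_fun_def)
  have "(\<lambda>\<omega>. \<Sum>\<sigma>\<in>PiE A (\<lambda>_. spins). g (fill d A \<sigma>) * indicator (cyl d A \<sigma>) \<omega>) \<in> borel_measurable (cfg_M d)"
    by measurable
  then show ?thesis
    by (subst measurable_cong[OF local_fun_expand[OF g]]) simp_all
qed

lemma local_fun_continuous: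
  fixes g :: "(nat list \<Rightarrow> int) \<Rightarrow> real"
  assumes g: "local_fun d A g" shows "continuous_map (cfg_top d) euclideanreal g"
proof -
  have A: "finite A" "A \<subseteq> tree_V d" using g by (auto simp: local_fun_def)
  have "openin (cfg_top d) {\<omega> \<in> cfg_space d. g \<omega> \<in> V}" for V
  proof (subst openin_subopen, safe)
    fix \<omega> assume \<omega>: "\<omega> \<in> cfg_space d" "g \<omega> \<in> V"
    have "openin (cfg_top d) (cyl d A \<omega>)"
      using A cfg_space_spin[OF \<omega>(1)] by (intro cyl_open) auto
    moreover have "\<omega> \<in> cyl d A \<omega>" using \<omega> by (simp add: cyl_def)
    moreover have "cyl d A \<omega> \<subseteq> {\<omega> \<in> cfg_space d. g \<omega> \<in> V}"
    proof
      fix \<omega>' assume *: "\<omega>' \<in> cyl d A \<omega>"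
      then have "g \<omega>' = g \<omega>" using \<omega> by (intro local_funD[OF g]) (simp_all add: cyl_def)
      then show "\<omega>' \<in> {\<omega> \<in> cfg_space d. g \<omega> \<in> V}" using * \<omega> by (simp add: cyl_def)
    qed
    ultimately show "\<exists>T. openin (cfg_top d) T \<and> \<omega> \<in> T \<and> T \<subseteq> {\<omega> \<in> cfg_space d. g \<omega> \<in> V}" by blast
  qed
  then show ?thesis by (auto simp: continuous_map_def)
qed

lemma compact_cfg_top: "compact_space (cfg_top d)"
  unfolding cfg_top_def
  by (auto simp: compact_space_product_topology compact_space_discrete_topology)

lemma continuous_bounded:
  assumes "continuous_map (cfg_top d) euclideanreal f"
  obtains K where "\<And>\<omega>. \<omega> \<in> cfg_space d \<Longrightarrow> \<bar>f \<omega>\<bar> \<le> K"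
proof -
  have "compactin euclideanreal (f ` topspace (cfg_top d))"
    using compact_cfg_top assms by (intro image_compactin[of "cfg_top d"]) (auto simp: compact_space_def)
  then have "bounded (f ` cfg_space d)" by (simp add: compact_imp_bounded)
  then show ?thesis using that by (auto simp: bounded_iff)
qed

text \<open>A local approximation obtained by freezing the spins outside a ball: it inherits
  monotonicity and bounds from f, and converges to f pointwise when f is continuous.\<close>

definition cutoff :: "nat \<Rightarrow> nat \<Rightarrow> ((nat list \<Rightarrow> int) \<Rightarrow> 'b) \<Rightarrow> (nat list \<Rightarrow> int) \<Rightarrow> 'b" where
  "cutoff d n f \<omega> = f (fill d (tree_ball d n) \<omega>)"

lemma fill_restrict_in_cfg_space: "\<omega> \<in> cfg_space d \<Longrightarrow> fill d A \<omega> \<in> cfg_space d"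
  by (rule fill_in_cfg_space) (rule cfg_space_spin)

lemma local_fun_cutoff: "local_fun d (tree_ball d n) (cutoff d n f)"
  unfolding local_fun_def cutoff_def
proof (intro conjI ballI impI)
  fix \<omega> \<omega>' :: "nat list \<Rightarrow> int" assume "\<forall>x\<in>tree_ball d n. \<omega> x = \<omega>' x"
  then have "fill d (tree_ball d n) \<omega> = fill d (tree_ball d n) \<omega>'" by (auto simp: fill_def)
  then show "f (fill d (tree_ball d n) \<omega>) = f (fill d (tree_ball d n) \<omega>')" by simp
qed (use tree_ball_subset in auto)

lemma increasing_cutoff:
  assumes "increasing_fun d f" shows "increasing_fun d (cutoff d n f)"
  unfolding increasing_fun_def cutoff_def
proof (intro ballI impI)
  fix \<omega> \<omega>' assume "\<omega> \<in> cfg_space d" "\<omega>' \<in> cfg_space d" "\<forall>x\<in>tree_V d. \<omega> x \<le> \<omega>' x"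
  moreover from this have "fill d A \<omega> x \<le> fill d A \<omega>' x" if "x \<in> tree_V d" for A x
    using that by (simp add: fill_def)
  ultimately show "f (fill d (tree_ball d n) \<omega>) \<le> f (fill d (tree_ball d n) \<omega>')"
    using assms fill_restrict_in_cfg_space unfolding increasing_fun_def by blast
qed

lemma cutoff_tendsto:
  assumes f: "continuous_map (cfg_top d) euclideanreal f" and \<omega>: "\<omega> \<in> cfg_space d"
  shows "(\<lambda>n. cutoff d n f \<omega>) \<longlonglongrightarrow> f \<omega>"
proof -
  have "limitin (cfg_top d) (\<lambda>n. fill d (tree_ball d n) \<omega>) \<omega> sequentially"
    unfolding cfg_top_def limitin_componentwise
  proof (intro conjI ballI)
    show "\<omega> \<in> extensional (tree_V d)" using \<omega> by (simp add: cfg_space_def PiE_def)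
    show "\<forall>\<^sub>F n in sequentially. fill d (tree_ball d n) \<omega> \<in> topspace (product_topology (\<lambda>_. discrete_topology spins) (tree_V d))"
      using fill_restrict_in_cfg_space[OF \<omega>] by (auto simp: cfg_space_def)
    fix x assume x: "x \<in> tree_V d"
    have "\<forall>\<^sub>F n in sequentially. fill d (tree_ball d n) \<omega> x = \<omega> x"
      using eventually_ge_at_top[of "length x"]
      by eventually_elim (use x in \<open>auto simp: fill_def tree_ball_def\<close>)
    then show "limitin (discrete_topology spins) (\<lambda>n. fill d (tree_ball d n) \<omega> x) (\<omega> x) sequentially"
      using cfg_space_spin[OF \<omega> x] by (auto simp: limitin_def elim: eventually_mono)
  qed
  from continuous_map_limit[OF f this] show ?thesis
    by (simp add: cutoff_def o_def)
qed

text \<open>The \<sigma>-algebra is a product and not defined through the topology, so the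
  measurability of a continuous function is obtained from its local approximations.\<close>

lemma continuous_measurable:
  assumes "continuous_map (cfg_top d) euclideanreal f"
  shows "f \<in> borel_measurable (cfg_M d)"
  by (rule borel_measurable_LIMSEQ_real[of _ "\<lambda>n. cutoff d n f"])
    (auto intro: cutoff_tendsto[OF assms] local_fun_measurable[OF local_fun_cutoff])

section \<open>Probability measures on configurations and stochastic domination\<close>

definition cfg_prob :: "nat \<Rightarrow> (nat list \<Rightarrow> int) measure \<Rightarrow> bool" where
  "cfg_prob d \<mu> \<longleftrightarrow> prob_space \<mu> \<and> sets \<mu> = sets (cfg_M d)"

lemma cfg_prob_space: "cfg_prob d \<mu> \<Longrightarrow> space \<mu> = cfg_space d"
  unfolding cfg_prob_def using sets_eq_imp_space_eq[of \<mu> "cfg_M d"] by simp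

lemma bounded_integrable:
  fixes f :: "(nat list \<Rightarrow> int) \<Rightarrow> real"
  assumes \<mu>: "cfg_prob d \<mu>" and f: "f \<in> borel_measurable (cfg_M d)"
    and b: "\<And>\<omega>. \<omega> \<in> cfg_space d \<Longrightarrow> \<bar>f \<omega>\<bar> \<le> K"
  shows "integrable \<mu> f"
proof -
  interpret prob_space \<mu> using \<mu> by (simp add: cfg_prob_def)
  have "f \<in> borel_measurable \<mu>" using \<mu> f measurable_cong_sets[of \<mu> "cfg_M d"] by (auto simp: cfg_prob_def)
  then show ?thesis
    using b cfg_prob_space[OF \<mu>] by (intro integrable_const_bound[of _ K]) auto
qed

lemma local_integral:
  fixes g :: "(nat list \<Rightarrow> int) \<Rightarrow> real"
  assumes \<mu>: "cfg_prob d \<mu>" and g: "local_fun d A g"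
  shows "(\<integral>\<omega>. g \<omega> \<partial>\<mu>) = (\<Sum>\<sigma>\<in>PiE A (\<lambda>_. spins). g (fill d A \<sigma>) * measure \<mu> (cyl d A \<sigma>))"
    and "integrable \<mu> g"
proof -
  interpret prob_space \<mu> using \<mu> by (simp add: cfg_prob_def)
  have c [measurable]: "cyl d A \<sigma> \<in> sets \<mu>" for \<sigma>
    using g \<mu> cyl_sets by (auto simp: local_fun_def cfg_prob_def)
  have i: "integrable \<mu> (\<lambda>\<omega>. g (fill d A \<sigma>) * indicator (cyl d A \<sigma>) \<omega>)" for \<sigma>
    by (intro integrable_mult_right integrable_real_indicator) (auto simp: emeasure_eq_measure)
  have "(\<integral>\<omega>. g \<omega> \<partial>\<mu>) = (\<integral>\<omega>. (\<Sum>\<sigma>\<in>PiE A (\<lambda>_. spins). g (fill d A \<sigma>) * indicator (cyl d A \<sigma>) \<omega>) \<partial>\<mu>)"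
    using local_fun_expand[OF g] cfg_prob_space[OF \<mu>] by (intro Bochner_Integration.integral_cong) auto
  also have "\<dots> = (\<Sum>\<sigma>\<in>PiE A (\<lambda>_. spins). g (fill d A \<sigma>) * measure \<mu> (cyl d A \<sigma>))"
    by (subst Bochner_Integration.integral_sum[OF i]) (simp_all add: cfg_prob_space[OF \<mu>] cyl_def Int_absorb2 Collect_conj_eq)
  finally show "(\<integral>\<omega>. g \<omega> \<partial>\<mu>) = (\<Sum>\<sigma>\<in>PiE A (\<lambda>_. spins). g (fill d A \<sigma>) * measure \<mu> (cyl d A \<sigma>))" .
  have "integrable \<mu> (\<lambda>\<omega>. \<Sum>\<sigma>\<in>PiE A (\<lambda>_. spins). g (fill d A \<sigma>) * indicator (cyl d A \<sigma>) \<omega>)"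
    using i by simp
  then show "integrable \<mu> g"
    by (subst Bochner_Integration.integrable_cong[OF refl local_fun_expand[OF g]])
      (use cfg_prob_space[OF \<mu>] in auto)
qed

text \<open>Dominated convergence along the cutoffs; the dominating constant exists because the
  configuration space is compact.\<close>

lemma stoch_le_localI:
  assumes \<mu>: "cfg_prob d \<mu>" and \<nu>: "cfg_prob d \<nu>"
    and le: "\<And>n g. local_fun d (tree_ball d n) g \<Longrightarrow> increasing_fun d g \<Longrightarrow> (\<integral>\<omega>. g \<omega> \<partial>\<mu>) \<le> (\<integral>\<omega>. g \<omega> \<partial>\<nu>)"
  shows "stoch_le d \<mu> \<nu>"
  unfolding stoch_le_def
proof safe
  fix f assume f: "continuous_map (cfg_top d) euclideanreal f" and inc: "increasing_fun d f"
  obtain K where K: "\<And>\<omega>. \<omega> \<in> cfg_space d \<Longrightarrow> \<bar>f \<omega>\<bar> \<le> K" using continuous_bounded[OF f] by metis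
  have lim: "(\<lambda>n. \<integral>\<omega>. cutoff d n f \<omega> \<partial>\<mu>) \<longlonglongrightarrow> (\<integral>\<omega>. f \<omega> \<partial>\<mu>)" if \<mu>: "cfg_prob d \<mu>" for \<mu>
  proof (rule integral_dominated_convergence[where w = "\<lambda>_. K"])
    interpret prob_space \<mu> using \<mu> by (simp add: cfg_prob_def)
    have m: "borel_measurable \<mu> = borel_measurable (cfg_M d)"
      using \<mu> by (intro measurable_cong_sets) (auto simp: cfg_prob_def)
    show "f \<in> borel_measurable \<mu>" unfolding m by (rule continuous_measurable[OF f])
    show "cutoff d n f \<in> borel_measurable \<mu>" for n
      unfolding m by (rule local_fun_measurable[OF local_fun_cutoff])
    show "AE \<omega> in \<mu>. (\<lambda>n. cutoff d n f \<omega>) \<longlonglongrightarrow> f \<omega>"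
      using cutoff_tendsto[OF f] cfg_prob_space[OF \<mu>] by auto
    show "AE \<omega> in \<mu>. norm (cutoff d n f \<omega>) \<le> K" for n
      using K fill_restrict_in_cfg_space cfg_prob_space[OF \<mu>] by (auto simp: cutoff_def)
    show "integrable \<mu> (\<lambda>_. K)" by simp
  qed
  show "(\<integral>\<omega>. f \<omega> \<partial>\<mu>) \<le> (\<integral>\<omega>. f \<omega> \<partial>\<nu>)"
  proof (rule LIMSEQ_le[OF lim[OF \<mu>] lim[OF \<nu>]])
    show "\<exists>N. \<forall>n\<ge>N. (\<integral>\<omega>. cutoff d n f \<omega> \<partial>\<mu>) \<le> (\<integral>\<omega>. cutoff d n f \<omega> \<partial>\<nu>)"
      by (intro exI allI impI le[OF local_fun_cutoff increasing_cutoff[OF inc]])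
  qed
qed

lemma stoch_leD:
  assumes "stoch_le d \<mu> \<nu>" "local_fun d A g" "increasing_fun d g"
  shows "(\<integral>\<omega>. g \<omega> \<partial>\<mu>) \<le> (\<integral>\<omega>. g \<omega> \<partial>\<nu>)"
  using assms(1,3) local_fun_continuous[OF assms(2)] by (simp add: stoch_le_def)

text \<open>Finite-dimensional product cylinders generate the \<sigma>-algebra, are closed under
  intersection and are local events.\<close>

lemma local_eqI:
  assumes fin: "finite_measure P" and P: "sets P = sets (cfg_M d)" and Q: "sets Q = sets (cfg_M d)"
    and eq: "\<And>A B. B \<in> sets (cfg_M d) \<Longrightarrow> local_fun d A (indicator B :: _ \<Rightarrow> real) \<Longrightarrow> emeasure P B = emeasure Q B"
  shows "P = Q"
proof (rule measure_eqI_PiM_infinite[where I = "tree_V d" and M = "\<lambda>_. count_space spins"])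
  show "sets P = sets (PiM (tree_V d) (\<lambda>_. count_space spins))"
    "sets Q = sets (PiM (tree_V d) (\<lambda>_. count_space spins))"
    using P Q by (simp_all add: cfg_M_def)
  fix A and I :: "nat list set"
  assume I: "finite I" "I \<subseteq> tree_V d" and A: "\<And>i. i \<in> I \<Longrightarrow> A i \<in> sets (count_space spins)"
  let ?B = "prod_emb (tree_V d) (\<lambda>_. count_space spins) I (Pi\<^sub>E I A)"
  have "?B \<in> sets (cfg_M d)" unfolding cfg_M_def using I A by (intro sets_PiM_I) auto
  moreover have B: "\<omega> \<in> ?B \<longleftrightarrow> (\<forall>x\<in>I. \<omega> x \<in> A x)" if "\<omega> \<in> cfg_space d" for \<omega>
    using that by (simp add: prod_emb_iff cfg_space_def PiE_iff)
  have "local_fun d I (indicator ?B :: _ \<Rightarrow> real)"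
    unfolding local_fun_def
  proof (intro conjI ballI impI)
    fix \<omega> \<omega>' assume *: "\<omega> \<in> cfg_space d" "\<omega>' \<in> cfg_space d" "\<forall>x\<in>I. \<omega> x = \<omega>' x"
    then have "\<omega> \<in> ?B \<longleftrightarrow> \<omega>' \<in> ?B" by (simp add: B)
    then show "indicator ?B \<omega> = (indicator ?B \<omega>' :: real)" by (simp add: indicator_def)
  qed (use I in auto)
  ultimately show "emeasure P ?B = emeasure Q ?B" by (rule eq)
qed (rule fin)

text \<open>Every local function is thus a difference of increasing ones, so increasing functions separate measures.\<close>
lemma local_fun_plus_spins_increasing:
  fixes g :: "(nat list \<Rightarrow> int) \<Rightarrow> real"
  assumes g: "local_fun d A g" and K: "\<And>\<omega>. \<omega> \<in> cfg_space d \<Longrightarrow> \<bar>g \<omega>\<bar> \<le> K"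
  shows "increasing_fun d (\<lambda>\<omega>. g \<omega> + 2 * K * (\<Sum>x\<in>A. real_of_int (\<omega> x)))"
  unfolding increasing_fun_def
proof (intro ballI impI)
  fix \<omega> \<omega>' assume \<omega>: "\<omega> \<in> cfg_space d" "\<omega>' \<in> cfg_space d" and le: "\<forall>x\<in>tree_V d. \<omega> x \<le> \<omega>' x"
  have A: "finite A" "A \<subseteq> tree_V d" using g by (auto simp: local_fun_def)
  show "g \<omega> + 2 * K * (\<Sum>x\<in>A. real_of_int (\<omega> x)) \<le> g \<omega>' + 2 * K * (\<Sum>x\<in>A. real_of_int (\<omega>' x))"
  proof (cases "\<forall>x\<in>A. \<omega> x = \<omega>' x")
    case True
    then have "g \<omega> = g \<omega>'" using local_funD[OF g \<omega>] by blast
    moreover have "(\<Sum>x\<in>A. real_of_int (\<omega> x)) = (\<Sum>x\<in>A. real_of_int (\<omega>' x))"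
      using True by (intro sum.cong) auto
    ultimately show ?thesis by simp
  next
    case False
    then obtain x where x: "x \<in> A" "\<omega> x \<noteq> \<omega>' x" by blast
    have "(\<Sum>x\<in>A. \<omega> x) < (\<Sum>x\<in>A. \<omega>' x)"
      using A le x by (intro sum_strict_mono_ex1) (auto simp: order_less_le intro!: bexI[of _ x])
    \<comment> \<open>Spins are integers, so the sum grows by at least 1, and \<open>2 * K\<close>
      times this growth pays for any drop of g, which is at most \<open>2 * K\<close>.\<close>
    then have "(\<Sum>x\<in>A. \<omega> x) + 1 \<le> (\<Sum>x\<in>A. \<omega>' x)" by simp
    then have "real_of_int ((\<Sum>x\<in>A. \<omega> x) + 1) \<le> real_of_int (\<Sum>x\<in>A. \<omega>' x)" by (simp only: of_int_le_iff)
    moreover have "0 \<le> K" using K[OF \<omega>(1)] by linarith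
    ultimately have "2 * K * (real_of_int (\<Sum>x\<in>A. \<omega> x) + 1) \<le> 2 * K * real_of_int (\<Sum>x\<in>A. \<omega>' x)"
      by (intro mult_left_mono) auto
    then show ?thesis using K[OF \<omega>(1)] K[OF \<omega>(2)] by (simp add: algebra_simps)
  qed
qed

lemma stoch_le_antisym:
  assumes \<mu>: "cfg_prob d \<mu>" and \<nu>: "cfg_prob d \<nu>" and le: "stoch_le d \<mu> \<nu>" "stoch_le d \<nu> \<mu>"
  shows "\<mu> = \<nu>"
proof (rule local_eqI)
  interpret \<mu>: prob_space \<mu> using \<mu> by (simp add: cfg_prob_def)
  interpret \<nu>: prob_space \<nu> using \<nu> by (simp add: cfg_prob_def)
  show "finite_measure \<mu>" by unfold_locales
  show s: "sets \<mu> = sets (cfg_M d)" "sets \<nu> = sets (cfg_M d)" using \<mu> \<nu> by (auto simp: cfg_prob_def)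
  fix A B assume B: "B \<in> sets (cfg_M d)" and loc: "local_fun d A (indicator B :: _ \<Rightarrow> real)"
  have A: "finite A" "A \<subseteq> tree_V d" using loc by (auto simp: local_fun_def)
  let ?S = "\<lambda>\<omega>. 2 * 1 * (\<Sum>x\<in>A. real_of_int (\<omega> x))"
  let ?h = "\<lambda>\<omega>. (indicator B \<omega> :: real) + ?S \<omega>"
  have locS: "local_fun d A ?S" using A by (auto simp: local_fun_def intro!: sum.cong)
  have loch: "local_fun d A ?h"
    unfolding local_fun_def
  proof (intro conjI ballI impI)
    fix \<omega> \<omega>' assume *: "\<omega> \<in> cfg_space d" "\<omega>' \<in> cfg_space d" "\<forall>x\<in>A. \<omega> x = \<omega>' x"
    show "?h \<omega> = ?h \<omega>'"
      using local_funD[OF loc *(1,2)] local_funD[OF locS *(1,2)] *(3) by simp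
  qed (use A in auto)
  have "increasing_fun d ?h"
    by (rule local_fun_plus_spins_increasing[OF loc]) (auto simp: indicator_def)
  then have 1: "(\<integral>\<omega>. ?h \<omega> \<partial>\<mu>) = (\<integral>\<omega>. ?h \<omega> \<partial>\<nu>)"
    using stoch_leD[OF le(1) loch] stoch_leD[OF le(2) loch] by (intro antisym) auto
  have "increasing_fun d ?S" using A by (auto simp: increasing_fun_def intro!: sum_mono)
  then have 2: "(\<integral>\<omega>. ?S \<omega> \<partial>\<mu>) = (\<integral>\<omega>. ?S \<omega> \<partial>\<nu>)"
    using stoch_leD[OF le(1) locS] stoch_leD[OF le(2) locS] by (intro antisym) auto
  have "(\<integral>\<omega>. ?h \<omega> \<partial>\<rho>) = measure \<rho> B + (\<integral>\<omega>. ?S \<omega> \<partial>\<rho>)" if "cfg_prob d \<rho>" for \<rho>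
  proof -
    have "B \<inter> space \<rho> = B" using B sets.sets_into_space[of B "cfg_M d"] cfg_prob_space[OF that] by auto
    then show ?thesis
      by (subst Bochner_Integration.integral_add[OF local_integral(2)[OF that loc] local_integral(2)[OF that locS]]) simp
  qed
  then have "measure \<mu> B = measure \<nu> B" using 1 2 \<mu> \<nu> by simp
  then show "emeasure \<mu> B = emeasure \<nu> B" by (simp add: \<mu>.emeasure_eq_measure \<nu>.emeasure_eq_measure)
qed

section \<open>Markov chains on the tree\<close>

definition spin_prob :: "real \<Rightarrow> int \<Rightarrow> real" where
  "spin_prob a s = exp (real_of_int s * a) / (2 * cosh a)"

lemma spin_prob_pos: "0 < spin_prob a s"
  by (simp add: spin_prob_def)

lemma spin_prob_sum: "spin_prob a 1 + spin_prob a (- 1) = 1"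
  by (simp add: spin_prob_def cosh_def add_divide_distrib[symmetric] add_pos_pos less_imp_neq[symmetric])

lemma spin_prob_plus: "spin_prob a 1 = 1 / (1 + exp (- (2 * a)))"
proof -
  have "2 * cosh a = exp a * (1 + exp (- (2 * a)))"
    by (simp add: cosh_def distrib_left flip: exp_add)
  then show ?thesis by (simp add: spin_prob_def)
qed

lemma spin_prob_plus_le_iff: "spin_prob a 1 \<le> spin_prob b 1 \<longleftrightarrow> a \<le> b"
proof -
  have pos: "0 < 1 + exp (- (2 * c))" for c :: real by (intro add_pos_pos) auto
  have "spin_prob a 1 \<le> spin_prob b 1 \<longleftrightarrow> 1 + exp (- (2 * b)) \<le> 1 + exp (- (2 * a))"
    unfolding spin_prob_plus using pos[of a] pos[of b] by (simp add: field_simps)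
  then show ?thesis by simp
qed

lemma spin_prob_minus: "spin_prob a (- 1) = spin_prob (- a) 1"
  by (simp add: spin_prob_def)

lemma isCont_spin_prob: "isCont (\<lambda>a. spin_prob a s) a"
  unfolding spin_prob_def by (intro continuous_intros) simp

definition local_field :: "real \<Rightarrow> (nat list \<Rightarrow> real) \<Rightarrow> (nat list \<Rightarrow> int) \<Rightarrow> nat list \<Rightarrow> real" where
  "local_field J b \<sigma> x = b x + (if x = [] then 0 else J * real_of_int (\<sigma> (butlast x)))"

text \<open>The field is written out instead of calling \<open>local_field\<close>, so that the only
  recursive call is visibly the one at the parent \<open>butlast x\<close>.\<close>

function sampler :: "real \<Rightarrow> (nat list \<Rightarrow> real) \<Rightarrow> (nat list \<Rightarrow> real) \<Rightarrow> nat list \<Rightarrow> int" where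
  "sampler J b u x =
     (if u x \<le> spin_prob (b x + (if x = [] then 0 else J * real_of_int (sampler J b u (butlast x)))) 1
      then 1 else - 1)"
  by pat_completeness auto
termination by (relation "Wellfounded.measure (\<lambda>(J, b, u, x). length x)") auto

declare sampler.simps [simp del]

lemma sampler_eq:
  "sampler J b u x = (if u x \<le> spin_prob (local_field J b (sampler J b u) x) 1 then 1 else - 1)"
  unfolding local_field_def by (rule sampler.simps)

lemma sampler_spin [simp]: "sampler J b u x \<in> spins"
  by (subst sampler_eq) (simp add: spins_def)

definition unif :: "real measure" where "unif = uniform_measure lborel {0..1}"

definition noise :: "nat \<Rightarrow> (nat list \<Rightarrow> real) measure" where
  "noise d = PiM (tree_V d) (\<lambda>_. unif)"

lemma sets_unif [measurable_cong, simp]: "sets unif = sets borel"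
  by (simp add: unif_def)

lemma space_unif [simp]: "space unif = UNIV"
  by (simp add: unif_def)

lemma prob_space_unif: "prob_space unif"
  unfolding unif_def by (rule prob_space_uniform_measure) auto

lemma prob_space_noise: "prob_space (noise d)"
  unfolding noise_def using prob_space_unif by (intro prob_space_PiM) auto

lemma unif_atMost: "0 \<le> p \<Longrightarrow> p \<le> 1 \<Longrightarrow> measure unif {..p} = p"
proof -
  assume p: "0 \<le> p" "p \<le> 1"
  have "{0..1} \<inter> {..p} = {0..p}" using p by auto
  then show ?thesis using p by (simp add: unif_def measure_uniform_measure)
qed

text \<open>For a spin s, the values of the uniform variable that make \<open>sampler\<close> choose
  s in the field a.\<close>

definition spin_event :: "real \<Rightarrow> int \<Rightarrow> real set" where
  "spin_event a s = (if s = 1 then {..spin_prob a 1} else - {..spin_prob a 1})"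

lemma spin_event_sets [measurable]: "spin_event a s \<in> sets borel"
  by (simp add: spin_event_def)

lemma spin_event_measure:
  assumes "s \<in> spins" shows "measure unif (spin_event a s) = spin_prob a s"
proof -
  interpret prob_space unif by (rule prob_space_unif)
  have le: "0 \<le> spin_prob a 1" "spin_prob a 1 \<le> 1"
    using spin_prob_sum[of a] spin_prob_pos[of a 1] spin_prob_pos[of a "- 1"] by linarith+
  have "prob (- {..spin_prob a 1}) = 1 - spin_prob a 1"
    using prob_compl[of "{..spin_prob a 1}"] unif_atMost[OF le] by (simp add: Compl_eq_Diff_UNIV)
  then show ?thesis
    using spins_cases[OF assms] unif_atMost[OF le] spin_prob_sum[of a] by (auto simp: spin_event_def)
qed

lemma noise_coordinate [measurable]: "x \<in> tree_V d \<Longrightarrow> (\<lambda>u. u x) \<in> borel_measurable (noise d)"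
proof -
  assume "x \<in> tree_V d"
  then have "(\<lambda>u. u x) \<in> noise d \<rightarrow>\<^sub>M unif"
    unfolding noise_def by (rule measurable_component_singleton)
  then show ?thesis by (simp cong: measurable_cong_sets)
qed

lemma sampler_measurable:
  assumes "x \<in> tree_V d"
  shows "(\<lambda>u. sampler J b u x) \<in> noise d \<rightarrow>\<^sub>M count_space spins"
  using assms
proof (induction x rule: rev_induct)
  case Nil
  have "{u \<in> space (noise d). u [] \<le> spin_prob (b []) 1} \<in> sets (noise d)"
    by (intro borel_measurable_le) auto
  then show ?case
    by (subst sampler_eq[abs_def]) (auto simp: local_field_def spins_def intro!: measurable_If)
next
  case (snoc i x)
  have x: "x \<in> tree_V d" using snoc.prems by (simp add: append_in_tree_V)
  have f: "(\<lambda>a. spin_prob a 1) \<in> borel_measurable borel"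
    by (intro borel_measurable_continuous_onI continuous_at_imp_continuous_on ballI isCont_spin_prob)
  have g: "(\<lambda>s. b (x @ [i]) + J * real_of_int s) \<in> borel_measurable (count_space spins)" by simp
  have "(\<lambda>u. spin_prob (b (x @ [i]) + J * real_of_int (sampler J b u x)) 1) \<in> borel_measurable (noise d)"
    using measurable_compose[OF measurable_compose[OF snoc.IH[OF x] g] f] .
  then have "{u \<in> space (noise d). u (x @ [i]) \<le> spin_prob (b (x @ [i]) + J * real_of_int (sampler J b u x)) 1}
      \<in> sets (noise d)"
    using snoc.prems by (intro borel_measurable_le) auto
  then show ?case
    by (subst sampler_eq[abs_def]) (auto simp: local_field_def spins_def intro!: measurable_If)
qed

definition sample_cfg :: "nat \<Rightarrow> real \<Rightarrow> (nat list \<Rightarrow> real) \<Rightarrow> (nat list \<Rightarrow> real) \<Rightarrow> nat list \<Rightarrow> int" where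
  "sample_cfg d J b u = restrict (sampler J b u) (tree_V d)"

lemma sample_cfg_measurable: "sample_cfg d J b \<in> noise d \<rightarrow>\<^sub>M cfg_M d"
  unfolding sample_cfg_def[abs_def] cfg_M_def by (intro measurable_restrict sampler_measurable)

lemma sample_cfg_in_cfg_space: "sample_cfg d J b u \<in> cfg_space d"
  by (auto simp: sample_cfg_def cfg_space_def)

definition markov :: "nat \<Rightarrow> real \<Rightarrow> (nat list \<Rightarrow> real) \<Rightarrow> (nat list \<Rightarrow> int) measure" where
  "markov d J b = distr (noise d) (cfg_M d) (sample_cfg d J b)"

lemma cfg_prob_markov: "cfg_prob d (markov d J b)"
  unfolding cfg_prob_def markov_def
  using prob_space.prob_space_distr[OF prob_space_noise sample_cfg_measurable] by simp

text \<open>Going down from the root, as long as the sampled spins agree with \<sigma>, the random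
  field at a vertex may be computed from \<sigma> instead. The event becomes a product of conditions
  on single uniform variables, so independence yields the product formula in
  \<open>markov_cyl\<close>.\<close>

lemma sampler_eq_iff:
  assumes A: "prefix_closed A" and \<sigma>: "\<And>x. x \<in> A \<Longrightarrow> \<sigma> x \<in> spins"
  shows "(\<forall>x\<in>A. sampler J b u x = \<sigma> x) \<longleftrightarrow> (\<forall>x\<in>A. u x \<in> spin_event (local_field J b \<sigma> x) (\<sigma> x))"
proof -
  have lf: "local_field J b (sampler J b u) x = local_field J b \<sigma> x"
    if "x \<noteq> [] \<Longrightarrow> sampler J b u (butlast x) = \<sigma> (butlast x)" for x
    using that by (simp add: local_field_def)
  have step: "sampler J b u x = \<sigma> x \<longleftrightarrow> u x \<in> spin_event (local_field J b \<sigma> x) (\<sigma> x)"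
    if "x \<in> A" "x \<noteq> [] \<Longrightarrow> sampler J b u (butlast x) = \<sigma> (butlast x)" for x
    using spins_cases[OF \<sigma>[OF that(1)]] sampler_eq[of J b u x] lf[OF that(2)]
    by (auto simp: spin_event_def split: if_splits)
  show ?thesis
  proof
    assume "\<forall>x\<in>A. sampler J b u x = \<sigma> x"
    then show "\<forall>x\<in>A. u x \<in> spin_event (local_field J b \<sigma> x) (\<sigma> x)"
      using step A unfolding prefix_closed_def by blast
  next
    assume ev: "\<forall>x\<in>A. u x \<in> spin_event (local_field J b \<sigma> x) (\<sigma> x)"
    have "x \<in> A \<longrightarrow> sampler J b u x = \<sigma> x" for x
    proof (induction x rule: rev_induct)
      case Nil
      then show ?case using step[of "[]"] ev by auto
    next
      case (snoc i x)
      show ?case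
      proof
        assume xi: "x @ [i] \<in> A"
        then have "x \<in> A" using A by (fastforce simp: prefix_closed_def)
        then show "sampler J b u (x @ [i]) = \<sigma> (x @ [i])" using step[OF xi] snoc ev xi by auto
      qed
    qed
    then show "\<forall>x\<in>A. sampler J b u x = \<sigma> x" by blast
  qed
qed

lemma markov_cyl:
  assumes A: "finite A" "A \<subseteq> tree_V d" "prefix_closed A" and \<sigma>: "\<And>x. x \<in> A \<Longrightarrow> \<sigma> x \<in> spins"
  shows "measure (markov d J b) (cyl d A \<sigma>) = (\<Prod>x\<in>A. spin_prob (local_field J b \<sigma> x) (\<sigma> x))"
proof -
  interpret product_prob_space "\<lambda>_. unif" "tree_V d"
    by (intro product_prob_spaceI prob_space_unif)
  let ?E = "\<lambda>x. spin_event (local_field J b \<sigma> x) (\<sigma> x)"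
  have sp: "space (noise d) = PiE (tree_V d) (\<lambda>_. UNIV)" by (simp add: noise_def space_PiM)
  have "sample_cfg d J b -` cyl d A \<sigma> \<inter> space (noise d)
      = {u \<in> space (noise d). \<forall>x\<in>A. sampler J b u x = \<sigma> x}"
    using A(2) sample_cfg_in_cfg_space by (auto simp: cyl_def sample_cfg_def subset_iff)
  also have "\<dots> = {u \<in> space (noise d). \<forall>x\<in>A. u x \<in> ?E x}"
    by (subst sampler_eq_iff[OF A(3) \<sigma>]) auto
  also have "\<dots> = prod_emb (tree_V d) (\<lambda>_. unif) A (PiE A ?E)"
    by (auto simp: prod_emb_iff sp PiE_iff)
  finally have "measure (markov d J b) (cyl d A \<sigma>) = measure (noise d) (prod_emb (tree_V d) (\<lambda>_. unif) A (PiE A ?E))"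
    unfolding markov_def by (subst measure_distr[OF sample_cfg_measurable cyl_sets[OF A(1,2)]]) simp
  also have "\<dots> = (\<Prod>x\<in>A. measure unif (?E x))"
    unfolding noise_def by (rule measure_PiM_emb[OF A(2,1)]) simp
  finally show ?thesis using \<sigma> by (simp add: spin_event_measure)
qed

text \<open>The condition \<open>step\<close> ranges over ordered pairs of parent spins because the
  two coupled chains may disagree at the parent.\<close>

lemma markov_stoch_le:
  assumes root: "b [] \<le> b' []"
    and step: "\<And>x s s'. x \<in> tree_V d \<Longrightarrow> x \<noteq> [] \<Longrightarrow> s \<in> spins \<Longrightarrow> s' \<in> spins \<Longrightarrow> s \<le> s' \<Longrightarrow>
      b x + J * real_of_int s \<le> b' x + J' * real_of_int s'"
  shows "stoch_le d (markov d J b) (markov d J' b')"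
  unfolding stoch_le_def
proof safe
  fix f assume f: "continuous_map (cfg_top d) euclideanreal f" and inc: "increasing_fun d f"
  have le: "x \<in> tree_V d \<longrightarrow> sampler J b u x \<le> sampler J' b' u x" for u x
  proof (induction x rule: rev_induct)
    case Nil
    then show ?case
      using root spin_prob_plus_le_iff[of "b []" "b' []"]
      by (subst (1 2) sampler_eq) (auto simp: local_field_def)
  next
    case (snoc i x)
    show ?case
    proof
      assume xi: "x @ [i] \<in> tree_V d"
      then have "sampler J b u x \<le> sampler J' b' u x" using snoc by (simp add: append_in_tree_V)
      then have "local_field J b (sampler J b u) (x @ [i]) \<le> local_field J' b' (sampler J' b' u) (x @ [i])"
        using step[OF xi] by (simp add: local_field_def)
      then have "spin_prob (local_field J b (sampler J b u) (x @ [i])) 1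
          \<le> spin_prob (local_field J' b' (sampler J' b' u) (x @ [i])) 1"
        by (simp add: spin_prob_plus_le_iff)
      then show "sampler J b u (x @ [i]) \<le> sampler J' b' u (x @ [i])"
        by (subst (1 2) sampler_eq) auto
    qed
  qed
  obtain K where K: "\<And>\<omega>. \<omega> \<in> cfg_space d \<Longrightarrow> \<bar>f \<omega>\<bar> \<le> K" using continuous_bounded[OF f] by metis
  note m = continuous_measurable[OF f]
  interpret noise: prob_space "noise d" by (rule prob_space_noise)
  have int: "integrable (noise d) (\<lambda>u. f (sample_cfg d J b u))" for J b
    using K[OF sample_cfg_in_cfg_space] measurable_compose[OF sample_cfg_measurable m]
    by (intro noise.integrable_const_bound[of _ K]) auto
  have "(\<integral>u. f (sample_cfg d J b u) \<partial>noise d) \<le> (\<integral>u. f (sample_cfg d J' b' u) \<partial>noise d)"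
  proof (rule integral_mono[OF int int])
    show "f (sample_cfg d J b u) \<le> f (sample_cfg d J' b' u)" for u
    proof -
      have "\<forall>x\<in>tree_V d. sample_cfg d J b u x \<le> sample_cfg d J' b' u x"
        using le by (simp add: sample_cfg_def)
      then show ?thesis
        using inc sample_cfg_in_cfg_space unfolding increasing_fun_def by blast
    qed
  qed
  then show "(\<integral>\<omega>. f \<omega> \<partial>markov d J b) \<le> (\<integral>\<omega>. f \<omega> \<partial>markov d J' b')"
    unfolding markov_def by (simp add: integral_distr[OF sample_cfg_measurable m])
qed

text \<open>The extra \<open>phi J t\<close> at the root accounts for its additional child: if t = h
  + d \<phi>_J(t), the root field is h + (d + 1) \<phi>_J(t).\<close>

definition hom_field :: "real \<Rightarrow> real \<Rightarrow> nat list \<Rightarrow> real" where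
  "hom_field J t x = (if x = [] then t + phi J t else t)"

definition hom_markov :: "nat \<Rightarrow> real \<Rightarrow> real \<Rightarrow> (nat list \<Rightarrow> int) measure" where
  "hom_markov d J t = markov d J (hom_field J t)"

text \<open>Exponentiating turns the expression into \<open>(exp (2 * a) + 1) / 2\<close>.\<close>

lemma add_ln_cosh_mono:
  fixes a b :: real
  assumes "a \<le> b" shows "a + ln (cosh a) \<le> b + ln (cosh b)"
proof -
  have "exp (a + ln (cosh a)) \<le> exp (b + ln (cosh b))"
  proof -
    have e: "exp (c + ln (cosh c)) = (exp (2 * c) + 1) / 2" for c :: real
    proof -
      have "exp (c + ln (cosh c)) = exp c * cosh c" by (simp add: exp_add)
      also have "\<dots> = (exp (2 * c) + 1) / 2" by (simp add: cosh_def distrib_left flip: exp_add)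
      finally show ?thesis .
    qed
    show ?thesis unfolding e using assms by simp
  qed
  then show ?thesis by simp
qed

text \<open>With G(a) = a + ln cosh a, the root field is G(t + J) / 2 - G(-(t - J)) / 2, hence
  increasing in t + J and t - J separately. So the conditions at non-root vertices already imply the
  one at the root.\<close>

lemma root_field_mono:
  assumes "t1 + J1 \<le> t2 + J2" "t1 - J1 \<le> t2 - J2"
  shows "t1 + phi J1 t1 \<le> t2 + phi J2 t2"
proof -
  have eq: "t + phi J t = ((t + J) + ln (cosh (t + J))) / 2 - (- (t - J) + ln (cosh (- (t - J)))) / 2" for t J
    unfolding phi_eq cosh_minus by (simp add: field_simps)
  have "- (t2 - J2) \<le> - (t1 - J1)" using assms(2) by simp
  from add_ln_cosh_mono[OF this] show ?thesis
    unfolding eq using add_ln_cosh_mono[OF assms(1)] by argo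
qed

lemma hom_markov_stoch_le:
  assumes "t1 + J1 \<le> t2 + J2" "t1 - J1 \<le> t2 - J2" "0 < J1"
  shows "stoch_le d (hom_markov d J1 t1) (hom_markov d J2 t2)"
  unfolding hom_markov_def
proof (rule markov_stoch_le)
  show "hom_field J1 t1 [] \<le> hom_field J2 t2 []"
    using root_field_mono[OF assms(1,2)] by (simp add: hom_field_def)
  fix x :: "nat list" and s s' assume "x \<noteq> []" "s \<in> spins" "s' \<in> spins" "s \<le> s'"
  \<comment> \<open>For a minus parent on the left and a plus parent on the right,
    \<open>0 < J1\<close> closes the gap: t1 - J1 \<le> t1 + J1 \<le> t2 + J2.\<close>
  then show "hom_field J1 t1 x + J1 * real_of_int s \<le> hom_field J2 t2 x + J2 * real_of_int s'"
    using assms spins_cases[of s] spins_cases[of s'] by (auto simp: hom_field_def)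
qed

text \<open>An infinite path from the root; alternating two letters keeps the words reduced.\<close>

fun ray :: "nat \<Rightarrow> nat list" where
  "ray 0 = []"
| "ray (Suc n) = ray n @ [n mod 2]"

lemma ray_simps [simp]: "length (ray n) = n" "ray n = [] \<longleftrightarrow> n = 0" "butlast (ray (Suc n)) = ray n"
  by (induction n) (auto simp: butlast_append)

lemma ray_in_tree_V: "1 \<le> d \<Longrightarrow> ray n \<in> tree_V d"
proof (induction n)
  case (Suc n)
  have "ray n = [] \<or> last (ray n) \<noteq> n mod 2"
    by (cases n) (auto simp: mod_Suc)
  moreover have "n mod 2 \<le> d" using Suc.prems by (metis mod_less_divisor less_Suc_eq_le numeral_2_eq_2 order_trans zero_less_numeral One_nat_def)
  ultimately show ?case using Suc by (simp add: append_in_tree_V)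
qed simp

lemma hom_markov_ray:
  assumes d: "1 \<le> d" and s: "s \<in> spins"
  shows "measure (hom_markov d J t) (cyl d (ray ` {..n}) (\<lambda>_. s))
    = spin_prob (t + phi J t) s * spin_prob (t + J * real_of_int s) s ^ n"
proof -
  have inj: "inj_on ray {..n}" by (rule inj_onI) (metis ray_simps(1))
  have "prefix_closed (ray ` {..n})"
    unfolding prefix_closed_def
  proof (intro ballI impI)
    fix x assume "x \<in> ray ` {..n}" "x \<noteq> []"
    then obtain k where "x = ray (Suc k)" "Suc k \<le> n" by (auto simp: gr0_conv_Suc elim: not0_implies_Suc[elim_format])
    then show "butlast x \<in> ray ` {..n}" by auto
  qed
  then have "measure (hom_markov d J t) (cyl d (ray ` {..n}) (\<lambda>_. s))
      = (\<Prod>x\<in>ray ` {..n}. spin_prob (local_field J (hom_field J t) (\<lambda>_. s) x) s)"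
    unfolding hom_markov_def using ray_in_tree_V[OF d] s by (intro markov_cyl) auto
  also have "\<dots> = (\<Prod>k\<le>n. spin_prob (local_field J (hom_field J t) (\<lambda>_. s) (ray k)) s)"
    by (simp add: prod.reindex[OF inj])
  also have "\<dots> = spin_prob (t + phi J t) s * spin_prob (t + J * real_of_int s) s ^ n"
    by (simp add: prod.atMost_shift local_field_def hom_field_def del: ray.simps(2))
  finally show ?thesis .
qed

text \<open>If p exceeded q, the powers of p / q would outgrow any quotient of the prefactors. In
  the application the prefactors are the root probabilities.\<close>

lemma geometric_le_imp_le:
  fixes p q :: real
  assumes "0 < a" "0 < p" "0 < q" "\<And>n. a * p ^ n \<le> c * q ^ n"
  shows "p \<le> q"
proof (rule ccontr)
  assume "\<not> p \<le> q"
  then have r: "1 < p / q" using assms by simp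
  obtain n where n: "c / a < (p / q) ^ n" using real_arch_pow[OF r] by blast
  have "a * (p / q) ^ n \<le> c" using assms(4)[of n] assms by (simp add: power_divide field_simps)
  then show False using n assms(1) by (simp add: field_simps)
qed

lemma local_fun_indicator_cyl:
  assumes "finite A" "A \<subseteq> tree_V d"
  shows "local_fun d A (indicator (cyl d A \<sigma>) :: _ \<Rightarrow> real)"
  using assms by (auto simp: local_fun_def cyl_def indicator_def)

text \<open>The indicator of an all-plus path and the negated indicator of an all-minus path are
  increasing; each yields one of the two inequalities by comparing decay rates.\<close>

lemma hom_markov_stoch_leD:
  assumes d: "1 \<le> d" and le: "stoch_le d (hom_markov d J1 t1) (hom_markov d J2 t2)"
  shows "t1 + J1 \<le> t2 + J2" "t1 - J1 \<le> t2 - J2"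
proof -
  define A where "A = (\<lambda>n. ray ` {..n})"
  have A: "finite (A n)" "A n \<subseteq> tree_V d" for n
    using ray_in_tree_V[OF d] by (auto simp: A_def)
  have I: "(\<integral>\<omega>. indicator (cyl d (A n) \<sigma>) \<omega> \<partial>hom_markov d J t) = measure (hom_markov d J t) (cyl d (A n) \<sigma>)" for n \<sigma> J t
    using cfg_prob_space[OF cfg_prob_markov, of d J "hom_field J t"]
    by (simp add: hom_markov_def cyl_def Collect_conj_eq Int_absorb2)
  note loc = local_fun_indicator_cyl[OF A]
  have plus: "increasing_fun d (indicator (cyl d (A n) (\<lambda>_. 1)) :: _ \<Rightarrow> real)" for n
    unfolding increasing_fun_def
  proof (intro ballI impI)
    fix \<omega> \<omega>' assume \<omega>: "\<omega> \<in> cfg_space d" "\<omega>' \<in> cfg_space d" "\<forall>x\<in>tree_V d. \<omega> x \<le> \<omega>' x"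
    have "\<omega>' \<in> cyl d (A n) (\<lambda>_. 1)" if "\<omega> \<in> cyl d (A n) (\<lambda>_. 1)"
    proof -
      have "\<omega>' x = 1" if "x \<in> A n" for x
        using \<omega> \<open>\<omega> \<in> cyl d (A n) (\<lambda>_. 1)\<close> that A(2)[of n] spins_cases[OF cfg_space_spin[OF \<omega>(2), of x]]
        by (force simp: cyl_def)
      then show ?thesis using \<omega> by (simp add: cyl_def)
    qed
    then show "indicator (cyl d (A n) (\<lambda>_. 1)) \<omega> \<le> (indicator (cyl d (A n) (\<lambda>_. 1)) \<omega>' :: real)"
      by (simp add: indicator_def)
  qed
  have minus: "increasing_fun d (\<lambda>\<omega>. - indicator (cyl d (A n) (\<lambda>_. - 1)) \<omega> :: real)" for n
    unfolding increasing_fun_def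
  proof (intro ballI impI)
    fix \<omega> \<omega>' assume \<omega>: "\<omega> \<in> cfg_space d" "\<omega>' \<in> cfg_space d" "\<forall>x\<in>tree_V d. \<omega> x \<le> \<omega>' x"
    have "\<omega> \<in> cyl d (A n) (\<lambda>_. - 1)" if "\<omega>' \<in> cyl d (A n) (\<lambda>_. - 1)"
    proof -
      have "\<omega> x = - 1" if "x \<in> A n" for x
        using \<omega> \<open>\<omega>' \<in> cyl d (A n) (\<lambda>_. - 1)\<close> that A(2)[of n] spins_cases[OF cfg_space_spin[OF \<omega>(1), of x]]
        by (force simp: cyl_def)
      then show ?thesis using \<omega> by (simp add: cyl_def)
    qed
    then show "- indicator (cyl d (A n) (\<lambda>_. - 1)) \<omega> \<le> (- indicator (cyl d (A n) (\<lambda>_. - 1)) \<omega>' :: real)"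
      by (simp add: indicator_def)
  qed
  have "measure (hom_markov d J1 t1) (cyl d (A n) (\<lambda>_. 1)) \<le> measure (hom_markov d J2 t2) (cyl d (A n) (\<lambda>_. 1))" for n
    using stoch_leD[OF le loc plus] unfolding I .
  then have "spin_prob (t1 + phi J1 t1) 1 * spin_prob (t1 + J1) 1 ^ n
      \<le> spin_prob (t2 + phi J2 t2) 1 * spin_prob (t2 + J2) 1 ^ n" for n
    using hom_markov_ray[OF d, of 1] by (simp add: A_def spins_def)
  from geometric_le_imp_le[OF spin_prob_pos spin_prob_pos spin_prob_pos this]
  have "spin_prob (t1 + J1) 1 \<le> spin_prob (t2 + J2) 1" .
  then show "t1 + J1 \<le> t2 + J2" by (simp add: spin_prob_plus_le_iff)
  have neg: "local_fun d (A n) (\<lambda>\<omega>. - indicator (cyl d (A n) \<sigma>) \<omega> :: real)" for n \<sigma>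
    using loc[of n \<sigma>] unfolding local_fun_def neg_equal_iff_equal .
  have "measure (hom_markov d J2 t2) (cyl d (A n) (\<lambda>_. - 1)) \<le> measure (hom_markov d J1 t1) (cyl d (A n) (\<lambda>_. - 1))" for n
    using stoch_leD[OF le neg minus, of n] unfolding Bochner_Integration.integral_minus I neg_le_iff_le .
  then have "spin_prob (t2 + phi J2 t2) (- 1) * spin_prob (t2 - J2) (- 1) ^ n
      \<le> spin_prob (t1 + phi J1 t1) (- 1) * spin_prob (t1 - J1) (- 1) ^ n" for n
    using hom_markov_ray[OF d, of "- 1"] by (simp add: A_def spins_def)
  from geometric_le_imp_le[OF spin_prob_pos spin_prob_pos spin_prob_pos this]
  have "spin_prob (t2 - J2) (- 1) \<le> spin_prob (t1 - J1) (- 1)" .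
  then have "- (t2 - J2) \<le> - (t1 - J1)" unfolding spin_prob_minus spin_prob_plus_le_iff .
  then show "t1 - J1 \<le> t2 - J2" by simp
qed

text \<open>The two inequalities bound t2 - t1 from below by J1 - J2 and by J2 - J1.\<close>

lemma hom_markov_stoch_le_iff:
  assumes "1 \<le> d" "0 < J1"
  shows "stoch_le d (hom_markov d J1 t1) (hom_markov d J2 t2) \<longleftrightarrow> t1 + \<bar>J1 - J2\<bar> \<le> t2"
  using hom_markov_stoch_le[of t1 J1 t2 J2 d] hom_markov_stoch_leD[OF assms(1), of J1 t1 J2 t2] assms
  by (auto simp: abs_if)

section \<open>Finite-volume Gibbs weights\<close>

text \<open>An adjacent pair is a parent and a child in one of the two orders, never in both; either
  kind is indexed by the child.\<close>

lemma sum_tree_adj: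
  fixes g :: "nat list \<Rightarrow> nat list \<Rightarrow> real"
  assumes X: "finite X" "X \<subseteq> tree_V d" and Y: "Y \<subseteq> tree_V d"
  shows "(\<Sum>(x, y)\<in>{(x, y). x \<in> X \<and> y \<in> Y \<and> tree_adj d x y}. g x y)
    = (\<Sum>x\<in>{x \<in> X. x \<noteq> [] \<and> butlast x \<in> Y}. g x (butlast x))
    + (\<Sum>y\<in>{y \<in> Y. y \<noteq> [] \<and> butlast y \<in> X}. g (butlast y) y)"
proof -
  let ?P = "{x \<in> X. x \<noteq> [] \<and> butlast x \<in> Y}" and ?Q = "{y \<in> Y. y \<noteq> [] \<and> butlast y \<in> X}"
  have adj: "tree_adj d x y \<longleftrightarrow> (y \<noteq> [] \<and> butlast y = x) \<or> (x \<noteq> [] \<and> butlast x = y)"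
    if "x \<in> tree_V d" "y \<in> tree_V d" for x y
    using that unfolding tree_adj_def by (metis append_butlast_last_id butlast_snoc snoc_eq_iff_butlast)
  have eq: "{(x, y). x \<in> X \<and> y \<in> Y \<and> tree_adj d x y} = (\<lambda>x. (x, butlast x)) ` ?P \<union> (\<lambda>y. (butlast y, y)) ` ?Q"
    using adj X(2) Y by (fastforce simp: image_iff)
  have "?Q \<subseteq> (\<Union>x\<in>X. children d x)" using Y by (auto simp: children_def)
  then have Q: "finite ?Q" by (rule finite_subset) (use X in auto)
  have disj: "(\<lambda>x. (x, butlast x)) ` ?P \<inter> (\<lambda>y. (butlast y, y)) ` ?Q = {}"
  proof -
    have False if "x = butlast y" "butlast x = y" "x \<noteq> []" for x y :: "nat list"
      using that by (metis length_butlast diff_le_self butlast.simps(1) length_0_conv diff_Suc_less length_greater_0_conv not_less One_nat_def)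
    then show ?thesis by auto
  qed
  show ?thesis
    unfolding eq using X Q disj
    by (subst sum.union_disjoint) (auto simp: sum.reindex inj_on_def)
qed

text \<open>The edges meeting U, each represented by its endpoint farther from the root.\<close>

definition edges_at :: "nat \<Rightarrow> nat list set \<Rightarrow> nat list set" where
  "edges_at d U = {x \<in> tree_V d. x \<noteq> [] \<and> (x \<in> U \<or> butlast x \<in> U)}"

text \<open>Interior and boundary interactions merge into one sum over edges of the glued
  configuration. The factor 1/2 disappears because \<open>sum_tree_adj\<close> lists each interior
  edge in both orders.\<close>

lemma ising_H_edges:
  assumes U: "finite U" "U \<subseteq> tree_V d"
  defines "\<omega> \<equiv> \<lambda>\<sigma> \<eta> x. if x \<in> U then \<sigma> x else \<eta> x"
  shows "ising_H d J h U \<sigma> \<eta> = J * (\<Sum>x\<in>edges_at d U. real_of_int (\<omega> \<sigma> \<eta> x * \<omega> \<sigma> \<eta> (butlast x)))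
    + h * (\<Sum>x\<in>U. real_of_int (\<sigma> x))"
proof -
  let ?w = "\<omega> \<sigma> \<eta>"
  let ?I = "{x \<in> U. x \<noteq> [] \<and> butlast x \<in> U}"
  let ?B1 = "{x \<in> U. x \<noteq> [] \<and> butlast x \<in> tree_V d - U}"
  let ?B2 = "{x \<in> tree_V d - U. x \<noteq> [] \<and> butlast x \<in> U}"
  have fin: "finite ?I" "finite ?B1" using U by auto
  have "?B2 \<subseteq> (\<Union>x\<in>U. children d x)" by (auto simp: children_def)
  then have fin2: "finite ?B2" by (rule finite_subset) (use U in auto)
  have inner: "(\<Sum>(x, y)\<in>{(x, y). x \<in> U \<and> y \<in> U \<and> tree_adj d x y}. real_of_int (\<sigma> x * \<sigma> y)) / 2
      = (\<Sum>x\<in>?I. real_of_int (?w x * ?w (butlast x)))"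
    unfolding sum_tree_adj[OF U U(2), of "\<lambda>x y. real_of_int (\<sigma> x * \<sigma> y)"]
    by (simp add: \<omega>_def mult.commute)
  have outer: "(\<Sum>(x, y)\<in>{(x, y). x \<in> U \<and> y \<in> tree_V d - U \<and> tree_adj d x y}. real_of_int (\<sigma> x * \<eta> y))
      = (\<Sum>x\<in>?B1. real_of_int (?w x * ?w (butlast x))) + (\<Sum>x\<in>?B2. real_of_int (?w x * ?w (butlast x)))"
    unfolding sum_tree_adj[OF U Diff_subset, of "\<lambda>x y. real_of_int (\<sigma> x * \<eta> y)"]
    by (simp add: \<omega>_def mult.commute)
  have "edges_at d U = (?I \<union> ?B1) \<union> ?B2"
    using U(2) butlast_in_tree_V by (auto simp: edges_at_def)
  then have "(\<Sum>x\<in>edges_at d U. real_of_int (?w x * ?w (butlast x)))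
      = (\<Sum>x\<in>?I \<union> ?B1. real_of_int (?w x * ?w (butlast x))) + (\<Sum>x\<in>?B2. real_of_int (?w x * ?w (butlast x)))"
    using fin fin2 by (simp only:) (rule sum.union_disjoint, auto)
  also have "(\<Sum>x\<in>?I \<union> ?B1. real_of_int (?w x * ?w (butlast x)))
      = (\<Sum>x\<in>?I. real_of_int (?w x * ?w (butlast x))) + (\<Sum>x\<in>?B1. real_of_int (?w x * ?w (butlast x)))"
    using fin by (intro sum.union_disjoint) auto
  finally show ?thesis
    unfolding ising_H_def inner outer by (simp only: add.assoc)
qed

lemma edges_at_subset: "U \<subseteq> tree_ball d n \<Longrightarrow> edges_at d U \<subseteq> tree_ball d (Suc n) - {[]}"
  by (auto simp: edges_at_def tree_ball_def)

text \<open>Neighbours of U lie at most one level further out, hence the radius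
  \<open>Suc n\<close>.\<close>

lemma ising_H_cong:
  assumes U: "U \<subseteq> tree_ball d n" and \<sigma>: "\<And>x. x \<in> U \<Longrightarrow> \<sigma> x = \<sigma>' x"
    and \<eta>: "\<And>x. x \<in> tree_ball d (Suc n) - U \<Longrightarrow> \<eta> x = \<eta>' x"
  shows "ising_H d J h U \<sigma> \<eta> = ising_H d J h U \<sigma>' \<eta>'"
proof -
  have fin: "finite U" "U \<subseteq> tree_V d"
    using U finite_subset[OF U] tree_ball_subset by auto
  have eq: "(if x \<in> U then \<sigma> x else \<eta> x) = (if x \<in> U then \<sigma>' x else \<eta>' x)" if "x \<in> tree_ball d (Suc n)" for x
    using that \<sigma> \<eta> by simp
  have "butlast x \<in> tree_ball d (Suc n)" "x \<in> tree_ball d (Suc n)" if "x \<in> edges_at d U" for x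
    using that edges_at_subset[OF U] prefix_closed_tree_ball[of d "Suc n"] by (auto simp: prefix_closed_def)
  then show ?thesis
    unfolding ising_H_edges[OF fin] using \<sigma>
    by (intro arg_cong2[where f = "(+)"] arg_cong2[where f = "(*)"] sum.cong refl) (simp_all only: eq)
qed

lemma ising_spec_cong:
  assumes U: "U \<subseteq> tree_ball d n" and \<sigma>: "\<And>x. x \<in> U \<Longrightarrow> \<sigma> x = \<sigma>' x"
    and \<eta>: "\<And>x. x \<in> tree_ball d (Suc n) - U \<Longrightarrow> \<eta> x = \<eta>' x"
  shows "ising_spec d J h U \<sigma> \<eta> = ising_spec d J h U \<sigma>' \<eta>'"
  unfolding ising_spec_def
  using ising_H_cong[OF U \<sigma> \<eta>] ising_H_cong[OF U refl \<eta>] by simp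

lemma local_fun_ising_spec:
  assumes "U \<subseteq> tree_ball d n"
  shows "local_fun d (tree_ball d (Suc n)) (ising_spec d J h U \<sigma>)"
  unfolding local_fun_def using tree_ball_subset
  by (auto intro!: ising_spec_cong[OF assms])

lemma ising_spec_bounds:
  assumes U: "finite U"
  shows "(\<Sum>\<tau>\<in>PiE U (\<lambda>_. spins). ising_spec d J h U \<tau> \<eta>) = 1"
    and "0 \<le> ising_spec d J h U \<sigma> \<eta>"
    and "\<sigma> \<in> PiE U (\<lambda>_. spins) \<Longrightarrow> ising_spec d J h U \<sigma> \<eta> \<le> 1"
proof -
  have fin: "finite (PiE U (\<lambda>_. spins))" using U by (simp add: finite_PiE)
  have "(\<lambda>x\<in>U. 1) \<in> PiE U (\<lambda>_. spins)" by (auto simp: spins_def)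
  then have "PiE U (\<lambda>_. spins) \<noteq> {}" by blast
  then have "0 < (\<Sum>\<tau>\<in>PiE U (\<lambda>_. spins). exp (ising_H d J h U \<tau> \<eta>))"
    using fin by (intro sum_pos) auto
  then show one: "(\<Sum>\<tau>\<in>PiE U (\<lambda>_. spins). ising_spec d J h U \<tau> \<eta>) = 1"
    unfolding ising_spec_def by (simp flip: sum_divide_distrib)
  show nn: "0 \<le> ising_spec d J h U \<sigma> \<eta>" for \<sigma>
    by (simp add: ising_spec_def sum_nonneg)
  show "ising_spec d J h U \<sigma> \<eta> \<le> 1" if "\<sigma> \<in> PiE U (\<lambda>_. spins)"
    using member_le_sum[of \<sigma> _ "\<lambda>\<sigma>. ising_spec d J h U \<sigma> \<eta>", OF that nn fin] one by simp
qed

text \<open>The Ising exponent of the ball alone, the outside being summarised by fields b on the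
  sphere of radius n; strictly inside, the field is h.\<close>

definition tree_weight :: "nat \<Rightarrow> real \<Rightarrow> real \<Rightarrow> nat \<Rightarrow> (nat list \<Rightarrow> real) \<Rightarrow> (nat list \<Rightarrow> int) \<Rightarrow> real" where
  "tree_weight d J h n b \<sigma> = J * (\<Sum>x\<in>tree_ball d n - {[]}. real_of_int (\<sigma> x * \<sigma> (butlast x)))
     + (\<Sum>x\<in>tree_ball d n. (if length x < n then h else b x) * real_of_int (\<sigma> x))"

text \<open>As s' takes only two values, \<open>ln (cosh (b + J * s'))\<close> is affine in it: the
  mean gives the constant denominator, the slope is \<open>phi J b\<close>. The normaliser of a
  child thus becomes a field acting on its parent.\<close>

lemma spin_prob_edge:
  assumes "s' \<in> spins"
  shows "spin_prob (b + J * real_of_int s') s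
    = exp (real_of_int s * b + J * real_of_int (s * s') - phi J b * real_of_int s')
      / (2 * exp ((ln (cosh (b + J)) + ln (cosh (b - J))) / 2))"
proof -
  let ?m = "(ln (cosh (b + J)) + ln (cosh (b - J))) / 2"
  have "cosh (b + J * real_of_int s') = exp (?m + phi J b * real_of_int s')"
  proof -
    have "?m + phi J b = ln (cosh (b + J))" "?m - phi J b = ln (cosh (b - J))"
      by (simp_all add: phi_eq field_simps)
    then show ?thesis using spins_cases[OF assms] by auto
  qed
  then show ?thesis
    unfolding spin_prob_def by (simp add: exp_add exp_diff algebra_simps)
qed

text \<open>Summing out the children of \<open>x\<close> shifts the field at \<open>x\<close> by the sum of the \<open>phi J (b y)\<close>; the
  recursion for \<open>b\<close> says that this turns the external field \<open>h\<close> into \<open>b x\<close>.\<close>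
lemma markov_tree_weight:
  assumes b: "\<And>x. x \<in> tree_V d \<Longrightarrow> length x < n \<Longrightarrow> b x = h + (\<Sum>y\<in>children d x. phi J (b y))"
  obtains C where "0 < C" "\<And>\<sigma>. (\<And>x. x \<in> tree_ball d n \<Longrightarrow> \<sigma> x \<in> spins) \<Longrightarrow>
    measure (markov d J b) (cyl d (tree_ball d n) \<sigma>) = C * exp (tree_weight d J h n b \<sigma>)"
proof -
  let ?B = "tree_ball d n"
  \<comment> \<open>The part of the normaliser at x that does not depend on the spins; the root has
    no parent, so there it is the whole normaliser.\<close>
  define D where "D x = (if x = [] then 2 * cosh (b x)
    else 2 * exp ((ln (cosh (b x + J)) + ln (cosh (b x - J))) / 2))" for x :: "nat list"
  have D: "0 < D x" for x by (simp add: D_def)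
  show ?thesis
  proof (rule that[of "1 / (\<Prod>x\<in>?B. D x)"])
    show "0 < 1 / (\<Prod>x\<in>?B. D x)" using D by (simp add: prod_pos)
    fix \<sigma> assume \<sigma>: "\<And>x. x \<in> ?B \<Longrightarrow> \<sigma> x \<in> spins"
    \<comment> \<open>The interaction of x with its parent, together with the field that the
      normaliser at x exerts on that parent.\<close>
    define e where "e x = (if x = [] then 0
      else J * real_of_int (\<sigma> x * \<sigma> (butlast x)) - phi J (b x) * real_of_int (\<sigma> (butlast x)))" for x
    have "spin_prob (local_field J b \<sigma> x) (\<sigma> x) = exp (b x * real_of_int (\<sigma> x) + e x) / D x" if x: "x \<in> ?B" for x
    proof (cases "x = []")
      case True
      then show ?thesis by (simp add: local_field_def spin_prob_def e_def D_def mult.commute)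
    next
      case False
      then have "\<sigma> (butlast x) \<in> spins"
        using x prefix_closed_tree_ball[of d n] by (intro \<sigma>) (simp add: prefix_closed_def)
      from spin_prob_edge[OF this, of "b x" J "\<sigma> x"] False show ?thesis
        by (simp add: local_field_def e_def D_def algebra_simps)
    qed
    then have "measure (markov d J b) (cyl d ?B \<sigma>) = (\<Prod>x\<in>?B. exp (b x * real_of_int (\<sigma> x) + e x) / D x)"
      using \<sigma> prefix_closed_tree_ball tree_ball_subset by (subst markov_cyl) auto
    also have "\<dots> = 1 / (\<Prod>x\<in>?B. D x) * exp ((\<Sum>x\<in>?B. b x * real_of_int (\<sigma> x)) + (\<Sum>x\<in>?B. e x))"
      by (simp add: prod_dividef exp_sum[symmetric] sum.distrib)
    also have "(\<Sum>x\<in>?B. b x * real_of_int (\<sigma> x)) + (\<Sum>x\<in>?B. e x) = tree_weight d J h n b \<sigma>"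
    proof -
      have "(\<Sum>x\<in>?B. e x) = (\<Sum>x\<in>?B - {[]}. e x)"
        by (rule sum.mono_neutral_right) (auto simp: e_def)
      also have "\<dots> = J * (\<Sum>x\<in>?B - {[]}. real_of_int (\<sigma> x * \<sigma> (butlast x)))
          - (\<Sum>x\<in>?B - {[]}. phi J (b x) * real_of_int (\<sigma> (butlast x)))"
        unfolding sum_distrib_left sum_subtractf[symmetric] by (intro sum.cong) (auto simp: e_def)
      \<comment> \<open>Collected at each parent x, these fields add up to b x - h by the
        recursion.\<close>
      also have "(\<Sum>x\<in>?B - {[]}. phi J (b x) * real_of_int (\<sigma> (butlast x)))
          = (\<Sum>x\<in>{x \<in> ?B. length x < n}. (b x - h) * real_of_int (\<sigma> x))"
        unfolding sum_edges_ball
      proof (rule sum.cong[OF refl])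
        fix x assume "x \<in> {x \<in> ?B. length x < n}"
        then have "b x - h = (\<Sum>y\<in>children d x. phi J (b y))" using b[of x] by (simp add: tree_ball_def)
        moreover have "(\<Sum>y\<in>children d x. phi J (b y) * real_of_int (\<sigma> (butlast y)))
            = (\<Sum>y\<in>children d x. phi J (b y) * real_of_int (\<sigma> x))"
          by (intro sum.cong) (auto simp: children_def)
        ultimately show "(\<Sum>y\<in>children d x. phi J (b y) * real_of_int (\<sigma> (butlast y))) = (b x - h) * real_of_int (\<sigma> x)"
          by (simp add: sum_distrib_right)
      qed
      also have "\<dots> = (\<Sum>x\<in>?B. if length x < n then (b x - h) * real_of_int (\<sigma> x) else 0)"
        by (simp add: sum.inter_filter)
      finally have "(\<Sum>x\<in>?B. e x) = J * (\<Sum>x\<in>?B - {[]}. real_of_int (\<sigma> x * \<sigma> (butlast x)))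
          - (\<Sum>x\<in>?B. if length x < n then (b x - h) * real_of_int (\<sigma> x) else 0)" .
      \<comment> \<open>Subtracting b x - h from b x leaves h at inner vertices; vertices on the
        sphere have no children in the ball and keep b x.\<close>
      moreover have "(\<Sum>x\<in>?B. (if length x < n then h else b x) * real_of_int (\<sigma> x))
          = (\<Sum>x\<in>?B. b x * real_of_int (\<sigma> x)) - (\<Sum>x\<in>?B. if length x < n then (b x - h) * real_of_int (\<sigma> x) else 0)"
        unfolding sum_subtractf[symmetric] by (intro sum.cong) (auto simp: algebra_simps)
      ultimately show ?thesis unfolding tree_weight_def by linarith
    qed
    finally show "measure (markov d J b) (cyl d ?B \<sigma>) = 1 / (\<Prod>x\<in>?B. D x) * exp (tree_weight d J h n b \<sigma>)" .
  qed
qed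

lemma ising_H_tree_ball:
  assumes b: "\<And>x. x \<in> tree_V d \<Longrightarrow> length x = n \<Longrightarrow> b x = h + J * (\<Sum>y\<in>children d x. real_of_int (\<eta> y))"
  shows "ising_H d J h (tree_ball d n) \<sigma> \<eta> = tree_weight d J h n b \<sigma>"
proof -
  let ?B = "tree_ball d n"
  let ?w = "\<lambda>x. if x \<in> ?B then \<sigma> x else \<eta> x"
  let ?L = "{x \<in> ?B. length x < n}" and ?M = "{x \<in> ?B. length x = n}"
  have BLM: "?B = ?L \<union> ?M" by (auto simp: tree_ball_def)
  have split: "(\<Sum>x\<in>?B. g x) = (\<Sum>x\<in>?L. g x) + (\<Sum>x\<in>?M. g x)" for g :: "nat list \<Rightarrow> real"
    by (subst BLM, rule sum.union_disjoint) auto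
  have "edges_at d ?B = tree_ball d (Suc n) - {[]}"
    by (auto simp: edges_at_def tree_ball_def butlast_in_tree_V)
  moreover have "{x \<in> tree_ball d (Suc n). length x < Suc n} = ?B" by (auto simp: tree_ball_def)
  ultimately have "(\<Sum>x\<in>edges_at d ?B. real_of_int (?w x * ?w (butlast x)))
      = (\<Sum>x\<in>?B. \<Sum>y\<in>children d x. real_of_int (?w y * ?w (butlast y)))"
    by (simp only: sum_edges_ball)
  also have "\<dots> = (\<Sum>x\<in>?L. \<Sum>y\<in>children d x. real_of_int (\<sigma> y * \<sigma> (butlast y)))
      + (\<Sum>x\<in>?M. (\<Sum>y\<in>children d x. real_of_int (\<eta> y)) * real_of_int (\<sigma> x))"
    unfolding split
  proof (intro arg_cong2[where f = "(+)"] sum.cong refl)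
    fix x y assume "x \<in> ?L" "y \<in> children d x"
    then have "y \<in> ?B" "butlast y \<in> ?B" by (auto simp: children_def tree_ball_def)
    then show "real_of_int (?w y * ?w (butlast y)) = real_of_int (\<sigma> y * \<sigma> (butlast y))" by simp
  next
    fix x assume x: "x \<in> ?M"
    have "real_of_int (?w y * ?w (butlast y)) = real_of_int (\<eta> y) * real_of_int (\<sigma> x)" if "y \<in> children d x" for y
    proof -
      have y: "y \<noteq> []" "butlast y = x" using that by (auto simp: children_def)
      then have "length y = Suc n" using x by (cases y rule: rev_cases) auto
      then have "y \<notin> ?B" "butlast y = x" using y by (auto simp: tree_ball_def)
      then show ?thesis using x by simp
    qed
    then show "(\<Sum>y\<in>children d x. real_of_int (?w y * ?w (butlast y)))
        = (\<Sum>y\<in>children d x. real_of_int (\<eta> y)) * real_of_int (\<sigma> x)"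
      by (simp add: sum_distrib_right)
  qed
  also have "(\<Sum>x\<in>?L. \<Sum>y\<in>children d x. real_of_int (\<sigma> y * \<sigma> (butlast y)))
      = (\<Sum>x\<in>?B - {[]}. real_of_int (\<sigma> x * \<sigma> (butlast x)))"
    by (rule sum_edges_ball[symmetric])
  finally have edges: "(\<Sum>x\<in>edges_at d ?B. real_of_int (?w x * ?w (butlast x)))
      = (\<Sum>x\<in>?B - {[]}. real_of_int (\<sigma> x * \<sigma> (butlast x)))
        + (\<Sum>x\<in>?M. (\<Sum>y\<in>children d x. real_of_int (\<eta> y)) * real_of_int (\<sigma> x))" .
  have M: "(\<Sum>x\<in>?M. b x * real_of_int (\<sigma> x))
      = h * (\<Sum>x\<in>?M. real_of_int (\<sigma> x)) + J * (\<Sum>x\<in>?M. (\<Sum>y\<in>children d x. real_of_int (\<eta> y)) * real_of_int (\<sigma> x))"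
    unfolding sum_distrib_left sum.distrib[symmetric]
    by (intro sum.cong refl) (simp add: b tree_ball_def sum_distrib_left[symmetric] algebra_simps)
  have "(\<Sum>x\<in>?B. (if length x < n then h else b x) * real_of_int (\<sigma> x))
      = h * (\<Sum>x\<in>?L. real_of_int (\<sigma> x)) + (\<Sum>x\<in>?M. b x * real_of_int (\<sigma> x))"
    unfolding split sum_distrib_left by (intro arg_cong2[where f = "(+)"] sum.cong) auto
  then show ?thesis
    unfolding ising_H_edges[OF finite_tree_ball tree_ball_subset] edges tree_weight_def M
    by (simp add: split algebra_simps)
qed

lemma ising_spec_eq_markov:
  assumes b: "\<And>x. x \<in> tree_V d \<Longrightarrow> length x < n \<Longrightarrow> b x = h + (\<Sum>y\<in>children d x. phi J (b y))"
    and leaf: "\<And>x. x \<in> tree_V d \<Longrightarrow> length x = n \<Longrightarrow> b x = h + J * (\<Sum>y\<in>children d x. real_of_int (\<eta> y))"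
    and \<sigma>: "\<sigma> \<in> PiE (tree_ball d n) (\<lambda>_. spins)"
  shows "ising_spec d J h (tree_ball d n) \<sigma> \<eta> = measure (markov d J b) (cyl d (tree_ball d n) \<sigma>)"
proof -
  let ?S = "PiE (tree_ball d n) (\<lambda>_. spins)"
  obtain C where C: "0 < C" and eq: "\<And>\<sigma>. (\<And>x. x \<in> tree_ball d n \<Longrightarrow> \<sigma> x \<in> spins) \<Longrightarrow>
      measure (markov d J b) (cyl d (tree_ball d n) \<sigma>) = C * exp (tree_weight d J h n b \<sigma>)"
    using markov_tree_weight[of d n b h J, OF b] by blast
  have law: "measure (markov d J b) (cyl d (tree_ball d n) \<tau>) = C * exp (ising_H d J h (tree_ball d n) \<tau> \<eta>)"
    if "\<tau> \<in> ?S" for \<tau>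
  proof -
    have "ising_H d J h (tree_ball d n) \<tau> \<eta> = tree_weight d J h n b \<tau>"
      by (rule ising_H_tree_ball) (rule leaf)
    then show ?thesis using that eq[of \<tau>] by auto
  qed
  interpret prob_space "markov d J b" using cfg_prob_markov by (simp add: cfg_prob_def)
  \<comment> \<open>The total mass 1 of the chain, written as a sum over cylinders, identifies 1 / C
    with the partition function.\<close>
  have "local_fun d (tree_ball d n) (\<lambda>_. 1 :: real)" using tree_ball_subset by (simp add: local_fun_def)
  from local_integral(1)[OF cfg_prob_markov this, of J b]
  have "1 = (\<Sum>\<tau>\<in>?S. measure (markov d J b) (cyl d (tree_ball d n) \<tau>))" by (simp add: prob_space)
  also have "\<dots> = C * (\<Sum>\<tau>\<in>?S. exp (ising_H d J h (tree_ball d n) \<tau> \<eta>))"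
    by (simp add: law sum_distrib_left)
  finally have "(\<Sum>\<tau>\<in>?S. exp (ising_H d J h (tree_ball d n) \<tau> \<eta>)) = 1 / C" using C by (simp add: field_simps)
  then show ?thesis unfolding ising_spec_def law[OF \<sigma>] using C by simp
qed

section \<open>Homogeneous chains are Gibbs measures\<close>

lemma hom_field_recursion:
  assumes t: "t = h + real d * phi J t" and x: "x \<in> tree_V d"
  shows "hom_field J t x = h + (\<Sum>y\<in>children d x. phi J (hom_field J t y))"
proof -
  have "(\<Sum>y\<in>children d x. phi J (hom_field J t y)) = (\<Sum>y\<in>children d x. phi J t)"
    by (intro sum.cong) (auto simp: children_def hom_field_def)
  also have "\<dots> = real (if x = [] then d + 1 else d) * phi J t"
    by (simp only: sum_constant card_children[OF x])
  finally show ?thesis using t by (simp add: hom_field_def algebra_simps)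
qed

text \<open>By n < m, all vertices of U carry the field h and all edges meeting U lie in the larger
  ball. The bracket therefore involves only spins outside U.\<close>

lemma tree_weight_split:
  assumes U: "U \<subseteq> tree_ball d n" and n: "n < m"
  shows "tree_weight d J h m b \<zeta> = ising_H d J h U \<zeta> \<zeta>
    + (J * (\<Sum>x\<in>tree_ball d m - {[]} - edges_at d U. real_of_int (\<zeta> x * \<zeta> (butlast x)))
      + (\<Sum>x\<in>tree_ball d m - U. (if length x < m then h else b x) * real_of_int (\<zeta> x)))"
proof -
  have Um: "U \<subseteq> tree_ball d m" using U tree_ball_mono[of n m d] n by auto
  have fin: "finite U" "U \<subseteq> tree_V d"
    using finite_subset[OF U] U tree_ball_subset by auto
  have "edges_at d U \<subseteq> tree_ball d m - {[]}"
    using edges_at_subset[OF U] tree_ball_mono[of "Suc n" m d] n by auto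
  then have "(\<Sum>x\<in>tree_ball d m - {[]}. real_of_int (\<zeta> x * \<zeta> (butlast x)))
      = (\<Sum>x\<in>tree_ball d m - {[]} - edges_at d U. real_of_int (\<zeta> x * \<zeta> (butlast x)))
        + (\<Sum>x\<in>edges_at d U. real_of_int (\<zeta> x * \<zeta> (butlast x)))"
    by (intro sum.subset_diff) auto
  moreover have "(\<Sum>x\<in>tree_ball d m. (if length x < m then h else b x) * real_of_int (\<zeta> x))
      = (\<Sum>x\<in>tree_ball d m - U. (if length x < m then h else b x) * real_of_int (\<zeta> x))
        + (\<Sum>x\<in>U. (if length x < m then h else b x) * real_of_int (\<zeta> x))"
    using Um by (intro sum.subset_diff) auto
  moreover have "(\<Sum>x\<in>U. (if length x < m then h else b x) * real_of_int (\<zeta> x)) = h * (\<Sum>x\<in>U. real_of_int (\<zeta> x))"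
    unfolding sum_distrib_left using U n by (intro sum.cong) (auto simp: tree_ball_def)
  ultimately show ?thesis
    unfolding ising_H_edges[OF fin] tree_weight_def by (simp add: distrib_left)
qed

text \<open>On the ball of radius m this is a finite computation. The weight of a configuration is
  the Ising weight of U times a factor blind to the spins in U, so weight times specification is
  symmetric under exchanging the spins in U for \<sigma> (\<open>balance\<close>). Summing over the
  exchanged spins then uses that the specification has total mass 1.\<close>

lemma hom_markov_detailed_balance:
  fixes g :: "(nat list \<Rightarrow> int) \<Rightarrow> real"
  assumes t: "t = h + real d * phi J t"
    and U: "U \<subseteq> tree_ball d n" and n: "n < m" and g: "local_fun d (tree_ball d m) g"
    and indep: "\<And>\<omega> \<omega>'. \<omega> \<in> cfg_space d \<Longrightarrow> \<omega>' \<in> cfg_space d \<Longrightarrow> (\<forall>x\<in>tree_V d - U. \<omega> x = \<omega>' x) \<Longrightarrow> g \<omega> = g \<omega>'"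
    and \<sigma>: "\<sigma> \<in> PiE U (\<lambda>_. spins)"
  shows "(\<integral>\<omega>. indicator (cyl d U \<sigma>) \<omega> * g \<omega> \<partial>hom_markov d J t) = (\<integral>\<omega>. ising_spec d J h U \<sigma> \<omega> * g \<omega> \<partial>hom_markov d J t)"
proof -
  let ?B = "tree_ball d m" and ?\<mu> = "hom_markov d J t"
  let ?S = "PiE ?B (\<lambda>_. spins)" and ?F = "fill d ?B"
  define w where "w \<zeta> = measure ?\<mu> (cyl d ?B \<zeta>)" for \<zeta>
  define rep where "rep \<zeta> \<tau> = (\<lambda>x\<in>?B. if x \<in> U then \<tau> x else \<zeta> x)" for \<zeta> \<tau> :: "nat list \<Rightarrow> int"
  have fin: "finite U" "U \<subseteq> tree_V d" using finite_subset[OF U] U tree_ball_subset by auto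
  have UB: "U \<subseteq> ?B" using U tree_ball_mono[of n m d] n by auto
  have nB: "tree_ball d (Suc n) \<subseteq> ?B" using tree_ball_mono[of "Suc n" m d] n by auto
  have F: "?F \<zeta> \<in> cfg_space d" if "\<zeta> \<in> ?S" for \<zeta> using that by (intro fill_in_cfg_space) auto
  have Fx: "?F \<zeta> x = \<zeta> x" if "x \<in> ?B" for \<zeta> x using that tree_ball_subset by (auto simp: fill_def)
  have rep_S: "rep \<zeta> \<tau> \<in> ?S" if "\<zeta> \<in> ?S" "\<tau> \<in> PiE U (\<lambda>_. spins)" for \<zeta> \<tau>
    using that by (auto simp: rep_def PiE_iff)
  obtain C where C: "0 < C" and wC: "\<And>\<zeta>. (\<And>x. x \<in> ?B \<Longrightarrow> \<zeta> x \<in> spins) \<Longrightarrow>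
      measure ?\<mu> (cyl d ?B \<zeta>) = C * exp (tree_weight d J h m (hom_field J t) \<zeta>)"
    using markov_tree_weight[of d m "hom_field J t" h J, OF hom_field_recursion[OF t]]
    unfolding hom_markov_def by blast
  have balance: "ising_spec d J h U \<sigma> (?F \<zeta>) * w \<zeta> = w (rep \<zeta> \<sigma>) * ising_spec d J h U (restrict \<zeta> U) (?F (rep \<zeta> \<sigma>))"
    if \<zeta>: "\<zeta> \<in> ?S" for \<zeta>
  proof -
    let ?\<zeta>' = "rep \<zeta> \<sigma>"
    define Z where "Z = (\<Sum>\<tau>\<in>PiE U (\<lambda>_. spins). exp (ising_H d J h U \<tau> \<zeta>))"
    have rep_off: "?\<zeta>' x = \<zeta> x" if "x \<in> ?B - U" for x using that by (simp add: rep_def)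
    have rep_on: "?\<zeta>' x = \<sigma> x" if "x \<in> U" for x using that UB by (auto simp: rep_def)
    have H1: "ising_H d J h U \<tau> (?F \<zeta>) = ising_H d J h U \<tau> \<zeta>" for \<tau>
      using Fx nB by (intro ising_H_cong[OF U]) auto
    have H2: "ising_H d J h U \<tau> (?F ?\<zeta>') = ising_H d J h U \<tau> \<zeta>" for \<tau>
      using Fx nB rep_off by (intro ising_H_cong[OF U]) auto
    have H3: "ising_H d J h U (restrict \<zeta> U) \<zeta> = ising_H d J h U \<zeta> \<zeta>"
      by (intro ising_H_cong[OF U]) auto
    have H4: "ising_H d J h U ?\<zeta>' ?\<zeta>' = ising_H d J h U \<sigma> \<zeta>"
      using rep_on rep_off nB by (intro ising_H_cong[OF U]) auto
    have bl: "butlast x \<in> ?B - U" if "x \<in> ?B - {[]} - edges_at d U" for x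
      using that prefix_closed_tree_ball[of d m] tree_ball_subset by (auto simp: prefix_closed_def edges_at_def)
    have x: "x \<in> ?B - U" if "x \<in> ?B - {[]} - edges_at d U" for x
      using that tree_ball_subset by (auto simp: edges_at_def)
    define R where "R \<zeta> = J * (\<Sum>x\<in>?B - {[]} - edges_at d U. real_of_int (\<zeta> x * \<zeta> (butlast x)))
      + (\<Sum>x\<in>?B - U. (if length x < m then h else hom_field J t x) * real_of_int (\<zeta> x))" for \<zeta> :: "nat list \<Rightarrow> int"
    have "R ?\<zeta>' = R \<zeta>"
      unfolding R_def
      by (intro arg_cong2[where f = "(+)"] arg_cong2[where f = "(*)"] sum.cong refl)
        (simp_all only: rep_off bl x)
    then have W: "tree_weight d J h m (hom_field J t) \<zeta> = ising_H d J h U \<zeta> \<zeta> + R \<zeta>"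
        "tree_weight d J h m (hom_field J t) ?\<zeta>' = ising_H d J h U \<sigma> \<zeta> + R \<zeta>"
      using tree_weight_split[OF U n, of J h "hom_field J t"] H4 by (simp_all add: R_def)
    have "w \<zeta> = C * exp (tree_weight d J h m (hom_field J t) \<zeta>)"
      unfolding w_def using \<zeta> by (intro wC) auto
    moreover have "w ?\<zeta>' = C * exp (tree_weight d J h m (hom_field J t) ?\<zeta>')"
      unfolding w_def using rep_S[OF \<zeta> \<sigma>] by (intro wC) auto
    ultimately show ?thesis
      unfolding ising_spec_def H1 H2 H3 W by (simp add: exp_add)
  qed
  define G where "G \<zeta> = w \<zeta> * g (?F \<zeta>)" for \<zeta>
  have g_rep: "g (?F \<zeta>) = g (?F (rep \<zeta> \<sigma>))" if "\<zeta> \<in> ?S" for \<zeta>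
    by (intro indep F rep_S that \<sigma>) (auto simp: fill_def rep_def)
  have \<mu>: "cfg_prob d ?\<mu>" unfolding hom_markov_def by (rule cfg_prob_markov)
  let ?T = "{\<zeta> \<in> ?S. \<forall>x\<in>U. \<zeta> x = \<sigma> x}"
  have finS: "finite ?S" by (simp add: finite_PiE)
  have "local_fun d ?B (\<lambda>\<omega>. ising_spec d J h U \<sigma> \<omega> * g \<omega>)"
    using local_fun_mono[OF local_fun_ising_spec[OF U, of J h \<sigma>] nB finite_tree_ball tree_ball_subset] g
    unfolding local_fun_def by metis
  from local_integral(1)[OF \<mu> this]
  have "(\<integral>\<omega>. ising_spec d J h U \<sigma> \<omega> * g \<omega> \<partial>?\<mu>)
      = (\<Sum>\<zeta>\<in>?S. ising_spec d J h U \<sigma> (?F \<zeta>) * g (?F \<zeta>) * w \<zeta>)" by (simp add: w_def)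
  also have "\<dots> = (\<Sum>\<zeta>\<in>?S. G (rep \<zeta> \<sigma>) * ising_spec d J h U (restrict \<zeta> U) (?F (rep \<zeta> \<sigma>)))"
  proof (rule sum.cong[OF refl])
    fix \<zeta> assume \<zeta>: "\<zeta> \<in> ?S"
    have "ising_spec d J h U \<sigma> (?F \<zeta>) * g (?F \<zeta>) * w \<zeta> = (ising_spec d J h U \<sigma> (?F \<zeta>) * w \<zeta>) * g (?F \<zeta>)" by simp
    then show "ising_spec d J h U \<sigma> (?F \<zeta>) * g (?F \<zeta>) * w \<zeta>
        = G (rep \<zeta> \<sigma>) * ising_spec d J h U (restrict \<zeta> U) (?F (rep \<zeta> \<sigma>))"
      unfolding balance[OF \<zeta>] g_rep[OF \<zeta>] G_def by simp
  qed
  \<comment> \<open>Configurations are grouped by what they become after overwriting U with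
    \<sigma>; a fibre is parametrised by the spins that were lost.\<close>
  also have "\<dots> = (\<Sum>\<xi>\<in>?T. \<Sum>\<zeta>\<in>{\<zeta> \<in> ?S. rep \<zeta> \<sigma> = \<xi>}. G (rep \<zeta> \<sigma>) * ising_spec d J h U (restrict \<zeta> U) (?F (rep \<zeta> \<sigma>)))"
  proof (rule sum.group[symmetric, OF finS])
    have "rep \<zeta> \<sigma> x = \<sigma> x" if "x \<in> U" for \<zeta> x using that UB by (auto simp: rep_def)
    then show "(\<lambda>\<zeta>. rep \<zeta> \<sigma>) ` ?S \<subseteq> ?T" using rep_S[OF _ \<sigma>] by blast
  qed (use finS in simp)
  also have "\<dots> = (\<Sum>\<xi>\<in>?T. G \<xi>)"
  proof (rule sum.cong[OF refl])
    fix \<xi> assume \<xi>: "\<xi> \<in> ?T"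
    have "(\<Sum>\<zeta>\<in>{\<zeta> \<in> ?S. rep \<zeta> \<sigma> = \<xi>}. G (rep \<zeta> \<sigma>) * ising_spec d J h U (restrict \<zeta> U) (?F (rep \<zeta> \<sigma>)))
        = (\<Sum>\<tau>\<in>PiE U (\<lambda>_. spins). G \<xi> * ising_spec d J h U \<tau> (?F \<xi>))"
    proof (rule sum.reindex_bij_witness[where i = "rep \<xi>" and j = "\<lambda>\<zeta>. restrict \<zeta> U"])
      fix \<zeta> assume \<zeta>: "\<zeta> \<in> {\<zeta> \<in> ?S. rep \<zeta> \<sigma> = \<xi>}"
      show "rep \<xi> (restrict \<zeta> U) = \<zeta>"
      proof (rule PiE_ext)
        have "restrict \<zeta> U \<in> PiE U (\<lambda>_. spins)" using \<zeta> UB by (auto simp: PiE_iff)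
        then show "rep \<xi> (restrict \<zeta> U) \<in> ?S" using \<xi> by (intro rep_S) auto
        show "\<zeta> \<in> ?S" using \<zeta> by simp
        show "rep \<xi> (restrict \<zeta> U) x = \<zeta> x" if "x \<in> ?B" for x
          using \<zeta> that by (auto simp: rep_def)
      qed
      show "restrict \<zeta> U \<in> PiE U (\<lambda>_. spins)" using \<zeta> UB by (auto simp: PiE_iff)
      show "G \<xi> * ising_spec d J h U (restrict \<zeta> U) (?F \<xi>)
          = G (rep \<zeta> \<sigma>) * ising_spec d J h U (restrict \<zeta> U) (?F (rep \<zeta> \<sigma>))" using \<zeta> by simp
    next
      fix \<tau> assume \<tau>: "\<tau> \<in> PiE U (\<lambda>_. spins)"
      show "restrict (rep \<xi> \<tau>) U = \<tau>"
      proof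
        fix x show "restrict (rep \<xi> \<tau>) U x = \<tau> x"
          using PiE_arb[OF \<tau>, of x] UB by (cases "x \<in> U") (auto simp: rep_def)
      qed
      have "rep (rep \<xi> \<tau>) \<sigma> = \<xi>"
      proof (rule PiE_ext)
        show "rep (rep \<xi> \<tau>) \<sigma> \<in> ?S" using \<xi> \<tau> \<sigma> by (intro rep_S) auto
        show "\<xi> \<in> ?S" using \<xi> by simp
        show "rep (rep \<xi> \<tau>) \<sigma> x = \<xi> x" if "x \<in> ?B" for x using \<xi> that by (auto simp: rep_def)
      qed
      then show "rep \<xi> \<tau> \<in> {\<zeta> \<in> ?S. rep \<zeta> \<sigma> = \<xi>}" using rep_S[of \<xi> \<tau>] \<xi> \<tau> by simp
    qed
    also have "\<dots> = G \<xi>" by (simp add: ising_spec_bounds(1)[OF fin(1)] flip: sum_distrib_left)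
    finally show "(\<Sum>\<zeta>\<in>{\<zeta> \<in> ?S. rep \<zeta> \<sigma> = \<xi>}. G (rep \<zeta> \<sigma>) * ising_spec d J h U (restrict \<zeta> U) (?F (rep \<zeta> \<sigma>))) = G \<xi>" .
  qed
  also have "\<dots> = (\<Sum>\<zeta>\<in>?S. if \<forall>x\<in>U. \<zeta> x = \<sigma> x then G \<zeta> else 0)"
    by (rule sum.inter_filter[OF finS])
  also have "\<dots> = (\<Sum>\<zeta>\<in>?S. indicator (cyl d U \<sigma>) (?F \<zeta>) * g (?F \<zeta>) * w \<zeta>)"
  proof (rule sum.cong[OF refl])
    fix \<zeta> assume "\<zeta> \<in> ?S"
    moreover have "?F \<zeta> x = \<zeta> x" if "x \<in> U" for x using that UB Fx by auto
    ultimately show "(if \<forall>x\<in>U. \<zeta> x = \<sigma> x then G \<zeta> else 0) = indicator (cyl d U \<sigma>) (?F \<zeta>) * g (?F \<zeta>) * w \<zeta>"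
      using F[of \<zeta>] by (simp add: cyl_def G_def indicator_def)
  qed
  also have "\<dots> = (\<integral>\<omega>. indicator (cyl d U \<sigma>) \<omega> * g \<omega> \<partial>?\<mu>)"
  proof -
    have "local_fun d ?B (\<lambda>\<omega>. indicator (cyl d U \<sigma>) \<omega> * g \<omega>)"
      using local_fun_mono[OF local_fun_indicator_cyl[OF fin, of \<sigma>] UB finite_tree_ball tree_ball_subset] g
      unfolding local_fun_def by metis
    from local_integral(1)[OF \<mu> this] show ?thesis by (simp add: w_def)
  qed
  finally show ?thesis by simp
qed

text \<open>Realises B \<mapsto> \<integral> f 1_B(r) d\<mu> as a measure, so that
  \<open>local_eqI\<close> can extend identities from local events to all events.\<close>

lemma emeasure_distr_density:
  assumes \<mu>: "cfg_prob d \<mu>" and r: "r \<in> cfg_M d \<rightarrow>\<^sub>M cfg_M d" and B: "B \<in> sets (cfg_M d)"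
    and f: "f \<in> borel_measurable (cfg_M d)" and bd: "\<And>\<omega>. 0 \<le> f \<omega>" "\<And>\<omega>. f \<omega> \<le> 1"
  shows "emeasure (distr (density \<mu> (\<lambda>\<omega>. ennreal (f \<omega>))) (cfg_M d) r) B
    = ennreal (\<integral>\<omega>. f \<omega> * indicator B (r \<omega>) \<partial>\<mu>)"
proof -
  have s: "sets \<mu> = sets (cfg_M d)" using \<mu> by (simp add: cfg_prob_def)
  note sp = cfg_prob_space[OF \<mu>]
  have r\<mu>: "r \<in> \<mu> \<rightarrow>\<^sub>M cfg_M d" using r s by (simp cong: measurable_cong_sets)
  have f\<mu>: "f \<in> borel_measurable \<mu>" using f s by (simp cong: measurable_cong_sets)
  have pre: "r -` B \<inter> space \<mu> \<in> sets \<mu>" using measurable_sets[OF r\<mu> B] .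
  have ind: "(\<lambda>\<omega>. indicator B (r \<omega>) :: real) \<in> borel_measurable (cfg_M d)"
    using measurable_compose[OF r borel_measurable_indicator[OF B]] .
  have "integrable \<mu> (\<lambda>\<omega>. f \<omega> * indicator B (r \<omega>))"
  proof (rule bounded_integrable[OF \<mu>])
    show "(\<lambda>\<omega>. f \<omega> * indicator B (r \<omega>)) \<in> borel_measurable (cfg_M d)" using f ind by measurable
    show "\<bar>f \<omega> * indicator B (r \<omega>)\<bar> \<le> 1" for \<omega> using bd[of \<omega>] by (simp add: indicator_def)
  qed
  then have "ennreal (\<integral>\<omega>. f \<omega> * indicator B (r \<omega>) \<partial>\<mu>) = (\<integral>\<^sup>+\<omega>. ennreal (f \<omega> * indicator B (r \<omega>)) \<partial>\<mu>)"
    using bd by (intro nn_integral_eq_integral[symmetric]) auto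
  also have "\<dots> = (\<integral>\<^sup>+\<omega>. ennreal (f \<omega>) * indicator (r -` B \<inter> space \<mu>) \<omega> \<partial>\<mu>)"
    by (intro nn_integral_cong) (auto simp: indicator_def)
  also have "\<dots> = emeasure (density \<mu> (\<lambda>\<omega>. ennreal (f \<omega>))) (r -` B \<inter> space \<mu>)"
    using f\<mu> pre by (subst emeasure_density) auto
  also have "\<dots> = emeasure (distr (density \<mu> (\<lambda>\<omega>. ennreal (f \<omega>))) (cfg_M d) r) B"
    using r\<mu> B by (subst emeasure_distr) auto
  finally show ?thesis by simp
qed

text \<open>Detailed balance treats local test functions, but the Gibbs property asks for arbitrary
  events outside U, and approximating such an event by local ones could bring in the spins of U.
  Overwriting U by a fixed spin before testing avoids this: two finite measures agree on local
  events, hence everywhere, and events outside U do not notice the overwriting.\<close>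

lemma is_gibbs_hom_markov:
  assumes t: "t = h + real d * phi J t"
  shows "is_gibbs d J h (hom_markov d J t)"
proof -
  let ?\<mu> = "hom_markov d J t"
  have \<mu>: "cfg_prob d ?\<mu>" unfolding hom_markov_def by (rule cfg_prob_markov)
  have "measure ?\<mu> ({\<omega> \<in> cfg_space d. \<forall>x\<in>U. \<omega> x = \<sigma> x} \<inter> B) = (\<integral>\<omega>. indicator B \<omega> * ising_spec d J h U \<sigma> \<omega> \<partial>?\<mu>)"
    if U: "finite U" "U \<subseteq> tree_V d" and \<sigma>: "\<sigma> \<in> PiE U (\<lambda>_. spins)" and B: "B \<in> sets (cfg_M d)"
      and inv: "\<forall>\<omega>\<in>cfg_space d. \<forall>\<omega>'\<in>cfg_space d. (\<forall>x\<in>tree_V d - U. \<omega> x = \<omega>' x) \<longrightarrow> (\<omega> \<in> B \<longleftrightarrow> \<omega>' \<in> B)"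
    for U \<sigma> B
  proof -
    obtain n where n: "U \<subseteq> tree_ball d n" using finite_subset_ball[OF U] by blast
    \<comment> \<open>Any fixed spin would do on U; all that matters is that
      \<open>r \<omega>\<close> depends only on the spins outside U.\<close>
    define r where "r \<omega> = (\<lambda>x\<in>tree_V d. if x \<in> U then 1 else \<omega> x)" for \<omega> :: "nat list \<Rightarrow> int"
    have r_space: "r \<omega> \<in> cfg_space d" if "\<omega> \<in> cfg_space d" for \<omega>
      using cfg_space_spin[OF that] by (auto simp: r_def cfg_space_def spins_def)
    have r: "r \<in> cfg_M d \<rightarrow>\<^sub>M cfg_M d"
      unfolding r_def[abs_def]
    proof (subst (2) cfg_M_def, rule measurable_restrict)
      fix x assume x: "x \<in> tree_V d"
      show "(\<lambda>\<omega>. if x \<in> U then 1 else \<omega> x) \<in> cfg_M d \<rightarrow>\<^sub>M count_space spins"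
        using coordinate_measurable[OF x] by (cases "x \<in> U") (auto simp: spins_def)
    qed
    let ?f = "indicator (cyl d U \<sigma>) :: _ \<Rightarrow> real" and ?g = "ising_spec d J h U \<sigma>"
    have f: "?f \<in> borel_measurable (cfg_M d)" using cyl_sets[OF U] by simp
    have g: "?g \<in> borel_measurable (cfg_M d)" using local_fun_measurable[OF local_fun_ising_spec[OF n]] .
    let ?N = "\<lambda>f. distr (density ?\<mu> (\<lambda>\<omega>. ennreal (f \<omega>))) (cfg_M d) r"
    have Nf: "emeasure (?N ?f) B = ennreal (\<integral>\<omega>. ?f \<omega> * indicator B (r \<omega>) \<partial>?\<mu>)" if "B \<in> sets (cfg_M d)" for B
      by (rule emeasure_distr_density[OF \<mu> r that f]) (auto simp: indicator_def)
    have Ng: "emeasure (?N ?g) B = ennreal (\<integral>\<omega>. ?g \<omega> * indicator B (r \<omega>) \<partial>?\<mu>)" if "B \<in> sets (cfg_M d)" for B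
      by (rule emeasure_distr_density[OF \<mu> r that g]) (use ising_spec_bounds[OF U(1)] \<sigma> in auto)
    have "?N ?f = ?N ?g"
    proof (rule local_eqI)
      show "finite_measure (?N ?f)"
      proof
        have "emeasure (?N ?f) (cfg_space d) \<noteq> \<infinity>"
          using Nf[of "cfg_space d"] sets.top[of "cfg_M d"] by simp
        then show "emeasure (?N ?f) (space (?N ?f)) \<noteq> \<infinity>" by simp
      qed
      fix A B assume B: "B \<in> sets (cfg_M d)" and loc: "local_fun d A (indicator B :: _ \<Rightarrow> real)"
      obtain k where k: "\<And>m. k \<le> m \<Longrightarrow> local_fun d (tree_ball d m) (indicator B :: _ \<Rightarrow> real)"
        using local_fun_ball[OF loc] by blast
      \<comment> \<open>\<open>Suc n\<close> secures the strict inequality n < m of the detailed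
        balance lemma.\<close>
      let ?m = "max k (Suc n)"
      have "(\<integral>\<omega>. ?f \<omega> * indicator B (r \<omega>) \<partial>?\<mu>) = (\<integral>\<omega>. ?g \<omega> * indicator B (r \<omega>) \<partial>?\<mu>)"
      proof (rule hom_markov_detailed_balance[OF t n _ _ _ \<sigma>])
        show "n < ?m" by simp
        have "local_fun d (tree_ball d ?m) (indicator B :: _ \<Rightarrow> real)" by (rule k) simp
        note loc' = local_funD[OF this r_space r_space]
        show "local_fun d (tree_ball d ?m) (\<lambda>\<omega>. indicator B (r \<omega>) :: real)"
          unfolding local_fun_def
        proof (intro conjI ballI impI)
          fix \<omega> \<omega>' assume "\<omega> \<in> cfg_space d" "\<omega>' \<in> cfg_space d" "\<forall>x\<in>tree_ball d ?m. \<omega> x = \<omega>' x"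
          then show "(indicator B (r \<omega>) :: real) = indicator B (r \<omega>')"
            by (intro loc') (auto simp: r_def)
        qed (use tree_ball_subset in auto)
        fix \<omega> \<omega>' :: "nat list \<Rightarrow> int" assume "\<forall>x\<in>tree_V d - U. \<omega> x = \<omega>' x"
        then have "r \<omega> = r \<omega>'" by (auto simp: r_def)
        then show "(indicator B (r \<omega>) :: real) = indicator B (r \<omega>')" by simp
      qed
      then show "emeasure (?N ?f) B = emeasure (?N ?g) B" by (simp add: Nf[OF B] Ng[OF B])
    qed simp_all
    then have "ennreal (\<integral>\<omega>. ?f \<omega> * indicator B (r \<omega>) \<partial>?\<mu>) = ennreal (\<integral>\<omega>. ?g \<omega> * indicator B (r \<omega>) \<partial>?\<mu>)"
      using Nf[OF B] Ng[OF B] by simp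
    then have eq: "(\<integral>\<omega>. ?f \<omega> * indicator B (r \<omega>) \<partial>?\<mu>) = (\<integral>\<omega>. ?g \<omega> * indicator B (r \<omega>) \<partial>?\<mu>)"
      using ising_spec_bounds(2)[OF U(1)] by (subst (asm) ennreal_inj) (auto intro!: Bochner_Integration.integral_nonneg)
    have rB: "indicator B (r \<omega>) = (indicator B \<omega> :: real)" if "\<omega> \<in> cfg_space d" for \<omega>
    proof -
      have "r \<omega> \<in> B \<longleftrightarrow> \<omega> \<in> B"
        by (rule inv[rule_format, OF r_space[OF that] that]) (simp add: r_def)
      then show ?thesis by (simp add: indicator_def)
    qed
    have "measure ?\<mu> ({\<omega> \<in> cfg_space d. \<forall>x\<in>U. \<omega> x = \<sigma> x} \<inter> B) = (\<integral>\<omega>. indicator (cyl d U \<sigma> \<inter> B) \<omega> \<partial>?\<mu>)"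
    proof -
      have "{\<omega> \<in> cfg_space d. \<forall>x\<in>U. \<omega> x = \<sigma> x} \<inter> B = cyl d U \<sigma> \<inter> B \<inter> space ?\<mu>"
        using cfg_prob_space[OF \<mu>] by (auto simp: cyl_def)
      then show ?thesis by simp
    qed
    also have "\<dots> = (\<integral>\<omega>. ?f \<omega> * indicator B (r \<omega>) \<partial>?\<mu>)"
      using cfg_prob_space[OF \<mu>] by (intro Bochner_Integration.integral_cong) (auto simp: rB indicator_inter_arith)
    also have "\<dots> = (\<integral>\<omega>. ?g \<omega> * indicator B (r \<omega>) \<partial>?\<mu>)" by (rule eq)
    also have "\<dots> = (\<integral>\<omega>. indicator B \<omega> * ?g \<omega> \<partial>?\<mu>)"
      using cfg_prob_space[OF \<mu>] by (intro Bochner_Integration.integral_cong) (auto simp: rB)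
    finally show ?thesis .
  qed
  then show ?thesis using \<mu> unfolding is_gibbs_def cfg_prob_def by blast
qed

section \<open>Comparison of Gibbs measures with homogeneous chains\<close>

fun cond_field :: "nat \<Rightarrow> real \<Rightarrow> real \<Rightarrow> (nat list \<Rightarrow> int) \<Rightarrow> nat \<Rightarrow> nat list \<Rightarrow> real" where
  "cond_field d J h \<eta> 0 x = h + J * (\<Sum>y\<in>children d x. real_of_int (\<eta> y))"
| "cond_field d J h \<eta> (Suc k) x = h + (\<Sum>y\<in>children d x. phi J (cond_field d J h \<eta> k y))"

fun field_iter :: "nat \<Rightarrow> real \<Rightarrow> real \<Rightarrow> real \<Rightarrow> nat \<Rightarrow> real" where
  "field_iter d J h a 0 = a"
| "field_iter d J h a (Suc k) = h + real d * phi J (field_iter d J h a k)"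

text \<open>The fields obtained from the constant field a on level n. The root combines d + 1
  children of level 1, hence the index n - 1. Below level n the truncated subtraction returns a, so
  that comparisons of fields hold on the whole tree.\<close>

definition level_field :: "nat \<Rightarrow> real \<Rightarrow> real \<Rightarrow> real \<Rightarrow> nat \<Rightarrow> nat list \<Rightarrow> real" where
  "level_field d J h a n x =
     (if x = [] then h + real (d + 1) * phi J (field_iter d J h a (n - 1))
      else field_iter d J h a (n - length x))"

text \<open>The base case bounds the sum of d spins by d in absolute value, and monotonicity of
  \<open>phi J\<close> carries the bounds up the tree. The root is excluded since it has d + 1
  children.\<close>

lemma cond_field_bounds:
  assumes J: "0 < J" and \<eta>: "\<eta> \<in> cfg_space d" and x: "x \<in> tree_V d" "x \<noteq> []"
  shows "field_iter d J h (h - real d * J) k \<le> cond_field d J h \<eta> k x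
    \<and> cond_field d J h \<eta> k x \<le> field_iter d J h (h + real d * J) k"
  using x
proof (induction k arbitrary: x)
  case 0
  have c: "card (children d x) = d" using card_children 0 by simp
  have "real_of_int (\<eta> y) \<in> {- 1, 1}" if "y \<in> children d x" for y
    using spins_cases[OF cfg_space_spin[OF \<eta>, of y]] that by (auto simp: children_def)
  then have b: "- 1 \<le> real_of_int (\<eta> y)" "real_of_int (\<eta> y) \<le> 1" if "y \<in> children d x" for y
    using that by fastforce+
  have "- real d \<le> (\<Sum>y\<in>children d x. real_of_int (\<eta> y))" "(\<Sum>y\<in>children d x. real_of_int (\<eta> y)) \<le> real d"
    using sum_mono[of "children d x" "\<lambda>_. - 1" "\<lambda>y. real_of_int (\<eta> y)"]
      sum_mono[of "children d x" "\<lambda>y. real_of_int (\<eta> y)" "\<lambda>_. 1"] b by (simp_all add: c)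
  then have "J * - real d \<le> J * (\<Sum>y\<in>children d x. real_of_int (\<eta> y))"
    "J * (\<Sum>y\<in>children d x. real_of_int (\<eta> y)) \<le> J * real d"
    using J by (intro mult_left_mono; simp)+
  then show ?case by (simp add: mult.commute)
next
  case (Suc k)
  have c: "card (children d x) = d" using card_children Suc.prems by simp
  have IH: "field_iter d J h (h - real d * J) k \<le> cond_field d J h \<eta> k y"
    "cond_field d J h \<eta> k y \<le> field_iter d J h (h + real d * J) k" if "y \<in> children d x" for y
    using Suc.IH[of y] that by (auto simp: children_def)
  have "(\<Sum>y\<in>children d x. phi J (field_iter d J h (h - real d * J) k)) \<le> (\<Sum>y\<in>children d x. phi J (cond_field d J h \<eta> k y))"
    "(\<Sum>y\<in>children d x. phi J (cond_field d J h \<eta> k y)) \<le> (\<Sum>y\<in>children d x. phi J (field_iter d J h (h + real d * J) k))"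
    using IH by (intro sum_mono phi_mono J; simp)+
  then show ?case by (simp add: c)
qed

lemma cond_field_level_bounds:
  assumes J: "0 < J" and \<eta>: "\<eta> \<in> cfg_space d" and x: "x \<in> tree_V d" and n: "0 < n"
  shows "level_field d J h (h - real d * J) n x \<le> cond_field d J h \<eta> (n - length x) x"
    and "cond_field d J h \<eta> (n - length x) x \<le> level_field d J h (h + real d * J) n x"
proof -
  have "level_field d J h (h - real d * J) n x \<le> cond_field d J h \<eta> (n - length x) x
    \<and> cond_field d J h \<eta> (n - length x) x \<le> level_field d J h (h + real d * J) n x"
  proof (cases "x = []")
    case False
    then show ?thesis using cond_field_bounds[OF J \<eta> x] by (simp add: level_field_def)
  next
    case True
    obtain k where k: "n = Suc k" using n gr0_conv_Suc by blast
    have c: "card (children d []) = d + 1" using card_children[of "[]" d] by simp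
    have b: "field_iter d J h (h - real d * J) k \<le> cond_field d J h \<eta> k y"
      "cond_field d J h \<eta> k y \<le> field_iter d J h (h + real d * J) k" if "y \<in> children d []" for y
      using cond_field_bounds[OF J \<eta>, of y h k] that by (auto simp: children_def)
    have "(\<Sum>y\<in>children d []. phi J (field_iter d J h (h - real d * J) k)) \<le> (\<Sum>y\<in>children d []. phi J (cond_field d J h \<eta> k y))"
      "(\<Sum>y\<in>children d []. phi J (cond_field d J h \<eta> k y)) \<le> (\<Sum>y\<in>children d []. phi J (field_iter d J h (h + real d * J) k))"
      using b by (intro sum_mono phi_mono J; simp)+
    then show ?thesis using True k by (simp add: level_field_def c)
  qed
  then show "level_field d J h (h - real d * J) n x \<le> cond_field d J h \<eta> (n - length x) x"
    and "cond_field d J h \<eta> (n - length x) x \<le> level_field d J h (h + real d * J) n x" by auto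
qed

lemma markov_field_mono:
  assumes J: "0 \<le> J" and b: "\<And>x. x \<in> tree_V d \<Longrightarrow> b x \<le> b' x"
  shows "stoch_le d (markov d J b) (markov d J b')"
  using b J by (intro markov_stoch_le) (auto intro!: add_mono mult_left_mono)

text \<open>For each outside configuration \<eta> the specification is the law of a chain whose
  fields are bounded independently of \<eta>; averaging over \<eta> under \<nu> keeps the
  bounds.\<close>

lemma is_gibbs_sandwich:
  fixes g :: "(nat list \<Rightarrow> int) \<Rightarrow> real"
  assumes J: "0 < J" and \<nu>: "is_gibbs d J h \<nu>" and n: "0 < n"
    and g: "local_fun d (tree_ball d n) g" and inc: "increasing_fun d g"
  shows "(\<integral>\<omega>. g \<omega> \<partial>markov d J (level_field d J h (h - real d * J) n)) \<le> (\<integral>\<omega>. g \<omega> \<partial>\<nu>)"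
    and "(\<integral>\<omega>. g \<omega> \<partial>\<nu>) \<le> (\<integral>\<omega>. g \<omega> \<partial>markov d J (level_field d J h (h + real d * J) n))"
proof -
  let ?B = "tree_ball d n" and ?S = "PiE (tree_ball d n) (\<lambda>_. spins)"
  let ?lo = "\<integral>\<omega>. g \<omega> \<partial>markov d J (level_field d J h (h - real d * J) n)"
  let ?hi = "\<integral>\<omega>. g \<omega> \<partial>markov d J (level_field d J h (h + real d * J) n)"
  have \<nu>p: "cfg_prob d \<nu>" using \<nu> by (simp add: is_gibbs_def cfg_prob_def)
  interpret prob_space \<nu> using \<nu>p by (simp add: cfg_prob_def)
  note sp = cfg_prob_space[OF \<nu>p]
  have mean: "?lo \<le> (\<Sum>\<sigma>\<in>?S. g (fill d ?B \<sigma>) * ising_spec d J h ?B \<sigma> \<eta>)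
      \<and> (\<Sum>\<sigma>\<in>?S. g (fill d ?B \<sigma>) * ising_spec d J h ?B \<sigma> \<eta>) \<le> ?hi"
    if \<eta>: "\<eta> \<in> cfg_space d" for \<eta>
  proof -
    define b where "b x = cond_field d J h \<eta> (n - length x) x" for x
    have "b x = h + (\<Sum>y\<in>children d x. phi J (b y))" if "length x < n" for x
    proof -
      have "(\<Sum>y\<in>children d x. phi J (b y)) = (\<Sum>y\<in>children d x. phi J (cond_field d J h \<eta> (n - Suc (length x)) y))"
      proof (rule sum.cong[OF refl])
        fix y assume "y \<in> children d x"
        then have "length y = Suc (length x)" by (cases y rule: rev_cases) (auto simp: children_def)
        then show "phi J (b y) = phi J (cond_field d J h \<eta> (n - Suc (length x)) y)" by (simp add: b_def)
      qed
      moreover have "n - length x = Suc (n - Suc (length x))" using that by simp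
      ultimately show ?thesis unfolding b_def by simp
    qed
    then have "(\<Sum>\<sigma>\<in>?S. g (fill d ?B \<sigma>) * ising_spec d J h ?B \<sigma> \<eta>)
        = (\<Sum>\<sigma>\<in>?S. g (fill d ?B \<sigma>) * measure (markov d J b) (cyl d ?B \<sigma>))"
      by (intro sum.cong refl arg_cong2[where f = "(*)"] ising_spec_eq_markov) (auto simp: b_def)
    also have "\<dots> = (\<integral>\<omega>. g \<omega> \<partial>markov d J b)" by (rule local_integral(1)[OF cfg_prob_markov g, symmetric])
    finally have eq: "(\<Sum>\<sigma>\<in>?S. g (fill d ?B \<sigma>) * ising_spec d J h ?B \<sigma> \<eta>) = (\<integral>\<omega>. g \<omega> \<partial>markov d J b)" .
    have "?lo \<le> (\<integral>\<omega>. g \<omega> \<partial>markov d J b)"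
      using J cond_field_level_bounds(1)[OF J \<eta> _ n]
      by (intro stoch_leD[OF markov_field_mono g inc]) (auto simp: b_def)
    moreover have "(\<integral>\<omega>. g \<omega> \<partial>markov d J b) \<le> ?hi"
      using J cond_field_level_bounds(2)[OF J \<eta> _ n]
      by (intro stoch_leD[OF markov_field_mono g inc]) (auto simp: b_def)
    ultimately show ?thesis unfolding eq by simp
  qed
  have int: "integrable \<nu> (\<lambda>\<eta>. g (fill d ?B \<sigma>) * ising_spec d J h ?B \<sigma> \<eta>)" for \<sigma>
    using local_integral(2)[OF \<nu>p local_fun_ising_spec[OF order_refl]] by simp
  have spec: "measure \<nu> (cyl d ?B \<sigma>) = (\<integral>\<eta>. ising_spec d J h ?B \<sigma> \<eta> \<partial>\<nu>)" if "\<sigma> \<in> ?S" for \<sigma>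
  proof -
    \<comment> \<open>The Gibbs property is applied with the whole space as the event outside the
      ball.\<close>
    have "measure \<nu> ({\<omega> \<in> cfg_space d. \<forall>x\<in>?B. \<omega> x = \<sigma> x} \<inter> cfg_space d)
        = (\<integral>\<eta>. indicator (cfg_space d) \<eta> * ising_spec d J h ?B \<sigma> \<eta> \<partial>\<nu>)"
      using \<nu> that tree_ball_subset sets.top[of "cfg_M d"] unfolding is_gibbs_def by simp
    moreover have "{\<omega> \<in> cfg_space d. \<forall>x\<in>?B. \<omega> x = \<sigma> x} \<inter> cfg_space d = cyl d ?B \<sigma>" by (auto simp: cyl_def)
    moreover have "(\<integral>\<eta>. indicator (cfg_space d) \<eta> * ising_spec d J h ?B \<sigma> \<eta> \<partial>\<nu>) = (\<integral>\<eta>. ising_spec d J h ?B \<sigma> \<eta> \<partial>\<nu>)"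
      by (intro Bochner_Integration.integral_cong) (auto simp: sp)
    ultimately show ?thesis by simp
  qed
  have "(\<integral>\<omega>. g \<omega> \<partial>\<nu>) = (\<Sum>\<sigma>\<in>?S. g (fill d ?B \<sigma>) * measure \<nu> (cyl d ?B \<sigma>))"
    by (rule local_integral(1)[OF \<nu>p g])
  also have "\<dots> = (\<Sum>\<sigma>\<in>?S. \<integral>\<eta>. g (fill d ?B \<sigma>) * ising_spec d J h ?B \<sigma> \<eta> \<partial>\<nu>)"
    by (intro sum.cong refl) (simp add: spec)
  also have "\<dots> = (\<integral>\<eta>. (\<Sum>\<sigma>\<in>?S. g (fill d ?B \<sigma>) * ising_spec d J h ?B \<sigma> \<eta>) \<partial>\<nu>)"
    by (rule Bochner_Integration.integral_sum[symmetric]) (rule int)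
  finally have eq: "(\<integral>\<omega>. g \<omega> \<partial>\<nu>) = (\<integral>\<eta>. (\<Sum>\<sigma>\<in>?S. g (fill d ?B \<sigma>) * ising_spec d J h ?B \<sigma> \<eta>) \<partial>\<nu>)" .
  have I: "integrable \<nu> (\<lambda>\<eta>. \<Sum>\<sigma>\<in>?S. g (fill d ?B \<sigma>) * ising_spec d J h ?B \<sigma> \<eta>)" using int by simp
  show "?lo \<le> (\<integral>\<omega>. g \<omega> \<partial>\<nu>)"
    unfolding eq using mean by (intro integral_ge_const[OF I]) (auto simp: sp)
  show "(\<integral>\<omega>. g \<omega> \<partial>\<nu>) \<le> ?hi"
    unfolding eq using mean by (intro integral_le_const[OF I]) (auto simp: sp)
qed

text \<open>The expectation of a local function is a finite sum of finite products of continuous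
  functions of the fields, so convergence of the field at each vertex suffices.\<close>

lemma markov_level_tendsto:
  fixes g :: "(nat list \<Rightarrow> int) \<Rightarrow> real"
  assumes lim: "field_iter d J h a \<longlonglongrightarrow> t" and t: "t = h + real d * phi J t"
    and g: "local_fun d (tree_ball d m) g"
  shows "(\<lambda>n. \<integral>\<omega>. g \<omega> \<partial>markov d J (level_field d J h a n)) \<longlonglongrightarrow> (\<integral>\<omega>. g \<omega> \<partial>hom_markov d J t)"
proof -
  let ?B = "tree_ball d m"
  have it: "(\<lambda>n. field_iter d J h a (n - k)) \<longlonglongrightarrow> t" for k
    by (rule filterlim_compose[OF lim filterlim_minus_const_nat_at_top])
  have "(\<lambda>n. h + real (d + 1) * phi J (field_iter d J h a (n - 1))) \<longlonglongrightarrow> h + real (d + 1) * phi J t"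
    by (intro tendsto_intros isCont_tendsto_compose[OF phi_cont] it)
  also have "h + real (d + 1) * phi J t = t + phi J t" using t by (simp add: algebra_simps)
  finally have lf: "(\<lambda>n. level_field d J h a n x) \<longlonglongrightarrow> hom_field J t x" for x
    using it by (simp add: level_field_def hom_field_def)
  have p: "(\<lambda>n. spin_prob (local_field J (level_field d J h a n) \<sigma> x) s) \<longlonglongrightarrow> spin_prob (local_field J (hom_field J t) \<sigma> x) s" for \<sigma> x s
    unfolding local_field_def by (intro isCont_tendsto_compose[OF isCont_spin_prob] tendsto_intros lf)
  have law: "(\<integral>\<omega>. g \<omega> \<partial>markov d J b) = (\<Sum>\<sigma>\<in>PiE ?B (\<lambda>_. spins). g (fill d ?B \<sigma>) *
      (\<Prod>x\<in>?B. spin_prob (local_field J b \<sigma> x) (\<sigma> x)))" for b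
    unfolding local_integral(1)[OF cfg_prob_markov g]
    by (intro sum.cong refl arg_cong2[where f = "(*)"] markov_cyl finite_tree_ball tree_ball_subset prefix_closed_tree_ball) auto
  show ?thesis
    unfolding hom_markov_def law by (intro tendsto_intros p)
qed

text \<open>Since \<open>phi J\<close> is at most J, the starting point h + d J lies above every
  fixed point and above its own image. The iterates decrease to a fixed point that is at least
  \<open>t_plus d J h\<close>, hence equal to it.\<close>

lemma field_iter_tendsto_t_plus:
  assumes J: "0 < J"
  shows "field_iter d J h (h + real d * J) \<longlonglongrightarrow> t_plus d J h"
proof -
  let ?s = "field_iter d J h (h + real d * J)"
  have tp: "t_plus d J h = h + real d * phi J (t_plus d J h)"
    unfolding ext_field_eq_iff by (rule t_plus_greatest(1)[OF J])
  have mono: "h + real d * phi J a \<le> h + real d * phi J b" if "a \<le> b" for a b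
    using phi_mono[OF J that] by (simp add: mult_left_mono)
  have low: "t_plus d J h \<le> ?s k" for k
  proof (induction k)
    case 0
    have "real d * phi J (t_plus d J h) \<le> real d * J" using phi_le[OF J] by (simp add: mult_left_mono)
    then show ?case using tp by simp
  next
    case (Suc k)
    then show ?case using mono[OF Suc] tp by simp
  qed
  have dec: "?s (Suc k) \<le> ?s k" for k
  proof (induction k)
    case 0
    then show ?case using phi_le[OF J] by (simp add: mult_left_mono)
  next
    case (Suc k)
    then show ?case using mono[OF Suc] by simp
  qed
  have "decseq ?s" using dec by (rule decseq_SucI)
  then obtain L where L: "?s \<longlonglongrightarrow> L" using decseq_convergent[of ?s "t_plus d J h"] low by blast
  have "(\<lambda>k. ?s (Suc k)) \<longlonglongrightarrow> h + real d * phi J L"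
    unfolding field_iter.simps by (intro tendsto_intros isCont_tendsto_compose[OF phi_cont] L)
  then have "L = h + real d * phi J L" using LIMSEQ_unique[OF LIMSEQ_Suc[OF L]] by blast
  then have "L \<le> t_plus d J h" unfolding ext_field_eq_iff by (rule t_plus_greatest(2)[OF J])
  moreover have "t_plus d J h \<le> L" using L low by (intro LIMSEQ_le_const) auto
  ultimately show ?thesis using L by simp
qed

text \<open>The spin flip maps these iterates to the upper ones for the field -h.\<close>

lemma field_iter_tendsto_t_minus:
  assumes J: "0 < J"
  shows "field_iter d J h (h - real d * J) \<longlonglongrightarrow> t_minus d J h"
proof -
  have "field_iter d J h (h - real d * J) k = - field_iter d J (- h) (- h + real d * J) k" for k
    by (induction k) (simp_all add: phi_minus)
  then have "field_iter d J h (h - real d * J) = (\<lambda>k. - field_iter d J (- h) (- h + real d * J) k)" by (rule ext)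
  then show ?thesis
    using tendsto_minus[OF field_iter_tendsto_t_plus[OF J, of d "- h"]] by (simp only: t_minus_eq[OF J])
qed

lemma is_gibbs_between:
  assumes J: "0 < J" and \<nu>: "is_gibbs d J h \<nu>"
  shows "stoch_le d \<nu> (hom_markov d J (t_plus d J h))"
    and "stoch_le d (hom_markov d J (t_minus d J h)) \<nu>"
proof -
  have \<nu>p: "cfg_prob d \<nu>" using \<nu> by (simp add: is_gibbs_def cfg_prob_def)
  have hp: "cfg_prob d (hom_markov d J t)" for t unfolding hom_markov_def by (rule cfg_prob_markov)
  have "(\<integral>\<omega>. g \<omega> \<partial>\<nu>) \<le> (\<integral>\<omega>. g \<omega> \<partial>hom_markov d J (t_plus d J h))
      \<and> (\<integral>\<omega>. g \<omega> \<partial>hom_markov d J (t_minus d J h)) \<le> (\<integral>\<omega>. g \<omega> \<partial>\<nu>)"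
    if g: "local_fun d (tree_ball d m) g" and inc: "increasing_fun d g" for m g
  proof -
    \<comment> \<open>The test function stays fixed while the ball grows; starting at
      \<open>Suc m\<close> also ensures n > 0.\<close>
    have gn: "local_fun d (tree_ball d n) g" if "Suc m \<le> n" for n
      using local_fun_mono[OF g tree_ball_mono finite_tree_ball tree_ball_subset] that by simp
    have lim: "(\<lambda>n. \<integral>\<omega>. g \<omega> \<partial>markov d J (level_field d J h (h + real d * J) n)) \<longlonglongrightarrow> (\<integral>\<omega>. g \<omega> \<partial>hom_markov d J (t_plus d J h))"
      "(\<lambda>n. \<integral>\<omega>. g \<omega> \<partial>markov d J (level_field d J h (h - real d * J) n)) \<longlonglongrightarrow> (\<integral>\<omega>. g \<omega> \<partial>hom_markov d J (t_minus d J h))"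
      using t_plus_greatest(1)[OF J] t_minus_least(1)[OF J]
      by (intro markov_level_tendsto[OF _ _ g] field_iter_tendsto_t_plus[OF J] field_iter_tendsto_t_minus[OF J];
          simp add: ext_field_eq_iff)+
    have "\<forall>\<^sub>F n in sequentially. (\<integral>\<omega>. g \<omega> \<partial>\<nu>) \<le> (\<integral>\<omega>. g \<omega> \<partial>markov d J (level_field d J h (h + real d * J) n))"
      using eventually_ge_at_top[of "Suc m"]
      by eventually_elim (rule is_gibbs_sandwich(2)[OF J \<nu> _ gn inc]; simp)
    moreover have "\<forall>\<^sub>F n in sequentially. (\<integral>\<omega>. g \<omega> \<partial>markov d J (level_field d J h (h - real d * J) n)) \<le> (\<integral>\<omega>. g \<omega> \<partial>\<nu>)"
      using eventually_ge_at_top[of "Suc m"]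
      by eventually_elim (rule is_gibbs_sandwich(1)[OF J \<nu> _ gn inc]; simp)
    ultimately show ?thesis
      using tendsto_lowerbound[OF lim(1)] tendsto_upperbound[OF lim(2)] by simp
  qed
  then show "stoch_le d \<nu> (hom_markov d J (t_plus d J h))" "stoch_le d (hom_markov d J (t_minus d J h)) \<nu>"
    by (auto intro!: stoch_le_localI[OF \<nu>p hp] stoch_le_localI[OF hp \<nu>p])
qed

section \<open>The domination thresholds\<close>

text \<open>The chain at t_+ dominates all Gibbs measures and is one of them; antisymmetry of
  domination makes it the only candidate for the definite description.\<close>

lemma plus_state_eq:
  assumes "0 < J" shows "plus_state d J h = hom_markov d J (t_plus d J h)"
  unfolding plus_state_def
proof (rule the_equality)
  have gibbs: "is_gibbs d J h (hom_markov d J (t_plus d J h))"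
    using t_plus_greatest(1)[OF assms] by (intro is_gibbs_hom_markov) (simp add: ext_field_eq_iff)
  then show "is_gibbs d J h (hom_markov d J (t_plus d J h))
      \<and> (\<forall>\<nu>. is_gibbs d J h \<nu> \<longrightarrow> stoch_le d \<nu> (hom_markov d J (t_plus d J h)))"
    using is_gibbs_between(1)[OF assms] by blast
  fix \<mu> assume \<mu>: "is_gibbs d J h \<mu> \<and> (\<forall>\<nu>. is_gibbs d J h \<nu> \<longrightarrow> stoch_le d \<nu> \<mu>)"
  show "\<mu> = hom_markov d J (t_plus d J h)"
  proof (rule stoch_le_antisym)
    show "cfg_prob d \<mu>" "cfg_prob d (hom_markov d J (t_plus d J h))"
      using \<mu> gibbs by (simp_all add: is_gibbs_def cfg_prob_def)
  qed (use \<mu> gibbs is_gibbs_between(1)[OF assms] in blast)+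
qed

lemma minus_state_eq:
  assumes "0 < J" shows "minus_state d J h = hom_markov d J (t_minus d J h)"
  unfolding minus_state_def
proof (rule the_equality)
  have gibbs: "is_gibbs d J h (hom_markov d J (t_minus d J h))"
    using t_minus_least(1)[OF assms] by (intro is_gibbs_hom_markov) (simp add: ext_field_eq_iff)
  then show "is_gibbs d J h (hom_markov d J (t_minus d J h))
      \<and> (\<forall>\<nu>. is_gibbs d J h \<nu> \<longrightarrow> stoch_le d (hom_markov d J (t_minus d J h)) \<nu>)"
    using is_gibbs_between(2)[OF assms] by blast
  fix \<mu> assume \<mu>: "is_gibbs d J h \<mu> \<and> (\<forall>\<nu>. is_gibbs d J h \<nu> \<longrightarrow> stoch_le d \<mu> \<nu>)"
  show "\<mu> = hom_markov d J (t_minus d J h)"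
  proof (rule stoch_le_antisym)
    show "cfg_prob d \<mu>" "cfg_prob d (hom_markov d J (t_minus d J h))"
      using \<mu> gibbs by (simp_all add: is_gibbs_def cfg_prob_def)
  qed (use \<mu> gibbs is_gibbs_between(2)[OF assms] in blast)+
qed

theorem theorem1p3:
  fixes d :: nat and J1 J2 h1 :: real and s :: bool
  assumes "d \<ge> 2" and "J1 > 0" and "J2 > 0"
  defines "\<tau> \<equiv> t_pm d s J1 h1 + \<bar>J1 - J2\<bar>"
  shows "(t_minus d J2 (- h_star d J2) \<le> \<tau> \<and> \<tau> < t_star d J2
            \<longrightarrow> f_pm d s J1 J2 h1 = - h_star d J2)
       \<and> (\<tau> \<ge> t_star d J2 \<or> \<tau> < t_minus d J2 (- h_star d J2)
            \<longrightarrow> f_pm d s J1 J2 h1 = \<tau> - real d * phi J2 \<tau>)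
       \<and> (- t_star d J2 < \<tau> \<and> \<tau> \<le> t_plus d J2 (h_star d J2)
            \<longrightarrow> g_pm d s J1 J2 h1 = h_star d J2)
       \<and> (\<tau> \<le> - t_star d J2 \<or> \<tau> > t_plus d J2 (h_star d J2)
            \<longrightarrow> g_pm d s J1 J2 h1 = \<tau> - real d * phi J2 \<tau>)"
proof -
  have d: "1 \<le> d" using \<open>d \<ge> 2\<close> by simp
  have pm: "pm_state d s J1 h1 = hom_markov d J1 (t_pm d s J1 h1)"
    using \<open>J1 > 0\<close> by (simp add: pm_state_def t_pm_def plus_state_eq minus_state_eq)
  \<comment> \<open>From here on only the extreme solutions t_+ and t_- for J2 remain; the measures
    have been eliminated.\<close>
  have f: "f_pm d s J1 J2 h1 = Inf {h. \<tau> \<le> t_plus d J2 h}"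
    unfolding f_pm_def pm plus_state_eq[OF \<open>J2 > 0\<close>] hom_markov_stoch_le_iff[OF d \<open>J1 > 0\<close>] \<tau>_def ..
  have g: "g_pm d s J1 J2 h1 = Inf {h. \<tau> \<le> t_minus d J2 h}"
    unfolding g_pm_def pm minus_state_eq[OF \<open>J2 > 0\<close>] hom_markov_stoch_le_iff[OF d \<open>J1 > 0\<close>] \<tau>_def ..
  show ?thesis
    unfolding f g
    using Inf_le_t_plus[OF \<open>J2 > 0\<close> d, of \<tau>] Inf_le_t_minus[OF \<open>J2 > 0\<close> d, of \<tau>]
    unfolding ext_field_def by blast
qed

end
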